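(* Let $\mathbf{f}=(f_1,\dots,f_r)$ be a complete factorization of a central hyperplane arrangement $f$ (possibly non-reduced) in $X=\mathbb{C}^n$. If $W$ is a dense edge in its intersection lattice, then $$\Big(\sum_{j\in J(W,\mathbf{f})}s_j+\operatorname{rank}(W)+k=0\Big)\subseteq Z(B_{\mathbf{f}})\subseteq\mathbb{C}^r$$ for all $k=0,1,\dots,|J(W,\mathbf{f})|-1$.
   Context: A hyperplane arrangement in $X=\mathbb{C}^n$ is a finite collection $D=\{D_1,\dots,D_p\}$ of hyperplanes. If $D_j$ is defined by the linear polynomial $\ell_j$, any product $f=\prod_j\ell_j^{m_j}$ with all $m_j\ge 1$ is also called a hyperplane arrangement (with support $D$). It is central if $\prod_j\ell_j$ is homogeneous. A complete factorization of a central $f$ is a tuple $\mathbf{f}=(f_1,\dots,f_r)$ of (homogeneous) linear polynomials with $\prod_{j=1}^r f_j=f$ (so $r=\deg f$). The intersection lattice is $L(D)=\{\bigcap_{H\in B}H\mid B\subseteq D\}$; its elements are edges. For an edge $W$: $D_W=\{H\in D\mid W\subseteq H\}$, $\operatorname{rank}(W)$ is the codimension of $W$ in $X$, and $J(W,\mathbf{f})=\{j\in\{1,\dots,r\}\mid W\subset(f_j=0)\}$. A central arrangement is irreducible if there is no linear change of coordinates on $\mathbb{C}^n$ such that its defining polynomial can be written as the product of two non-constant polynomials in disjoint sets of variables. An edge $W\ne X$ is dense if $D_W$ is irreducible. With $\mathbf{s}=(s_1,\dots,s_r)$ and $\mathbf{f}^{\mathbf{s}}=\prod_i f_i^{s_i}$,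 $B_{\mathbf{f}}\subseteq\mathbb{C}[\mathbf{s}]$ is the Bernstein-Sato ideal: the ideal of all $b(\mathbf{s})$ for which there is $P\in\mathscr{D}_X[\mathbf{s}]=\mathscr{D}_X\otimes_{\mathbb{C}}\mathbb{C}[\mathbf{s}]$ with $b(\mathbf{s})\mathbf{f}^{\mathbf{s}}=P\cdot\mathbf{f}^{\mathbf{s}+\mathbf{1}}$, where $\mathbf{f}^{\mathbf{s}+\mathbf{1}}=\prod_i f_i^{s_i+1}$. $Z(B_{\mathbf{f}})$ is its zero locus in $\mathbb{C}^r$. *)

theory Defs
  imports
    "HOL-Analysis.Analysis"
    "HOL-Library.Poly_Mapping"
    "HOL-Computational_Algebra.Fraction_Field"
begin

section \<open>Polynomials in finitely many variables\<close>

type_synonym ('v, 'a) mpoly = "('v \<Rightarrow>\<^sub>0 nat) \<Rightarrow>\<^sub>0 'a"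

type_synonym 'v cpoly = "('v, complex) mpoly"

definition Const :: "'a \<Rightarrow> ('v, 'a::zero) mpoly"
  where "Const c = Poly_Mapping.single 0 c"

definition Var :: "'v \<Rightarrow> ('v, 'a::zero_neq_one) mpoly"
  where "Var v = Poly_Mapping.single (Poly_Mapping.single v 1) 1"

definition vars :: "('v, 'a::zero) mpoly \<Rightarrow> 'v set"
  where "vars p = (\<Union>m\<in>Poly_Mapping.keys p. Poly_Mapping.keys m)"

definition mdegree :: "('v \<Rightarrow>\<^sub>0 nat) \<Rightarrow> nat"
  where "mdegree m = (\<Sum>v\<in>Poly_Mapping.keys m. Poly_Mapping.lookup m v)"

definition homogeneous :: "('v, 'a::zero) mpoly \<Rightarrow> bool"
  where "homogeneous p \<longleftrightarrow> (\<exists>d. \<forall>m\<in>Poly_Mapping.keys p. mdegree m = d)"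

text \<open>Polynomials of total degree exactly one, possibly with a constant term.\<close>
definition linear_poly :: "('v, 'a::zero) mpoly \<Rightarrow> bool"
  where "linear_poly p \<longleftrightarrow>
    (\<forall>m\<in>Poly_Mapping.keys p. mdegree m \<le> 1) \<and> (\<exists>m\<in>Poly_Mapping.keys p. mdegree m = 1)"

definition peval :: "complex ^ 'v::finite \<Rightarrow> 'v cpoly \<Rightarrow> complex"
  where "peval x p = (\<Sum>m\<in>Poly_Mapping.keys p.
    Poly_Mapping.lookup p m * (\<Prod>v\<in>UNIV. (x $ v) ^ Poly_Mapping.lookup m v))"

definition zeros :: "'v::finite cpoly \<Rightarrow> (complex ^ 'v) set"
  where "zeros p = {x. peval x p = 0}"

text \<open>The polynomial \<open>x \<mapsto> p (A x)\<close>.\<close>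
definition lin_change :: "complex ^ 'v ^ 'v \<Rightarrow> 'v::finite cpoly \<Rightarrow> 'v cpoly"
  where "lin_change A p = (\<Sum>m\<in>Poly_Mapping.keys p.
    Const (Poly_Mapping.lookup p m) *
      (\<Prod>v\<in>UNIV. (\<Sum>w\<in>UNIV. Const (A $ v $ w) * Var w) ^ Poly_Mapping.lookup m v))"


section \<open>Hyperplane arrangements\<close>

definition central_arrangement :: "(complex ^ 'n) set set \<Rightarrow> 'n::finite cpoly \<Rightarrow> bool"
  where "central_arrangement D f \<longleftrightarrow> finite D \<and>
    (\<exists>l m. (\<forall>H\<in>D. linear_poly (l H) \<and> H = zeros (l H) \<and> (1::nat) \<le> m H) \<and>
           f = (\<Prod>H\<in>D. l H ^ m H) \<and> homogeneous (\<Prod>H\<in>D. l H))"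

definition complete_factorization :: "('r::finite \<Rightarrow> 'n::finite cpoly) \<Rightarrow> 'n cpoly \<Rightarrow> bool"
  where "complete_factorization fs f \<longleftrightarrow>
    (\<forall>j. linear_poly (fs j) \<and> homogeneous (fs j)) \<and> (\<Prod>j\<in>UNIV. fs j) = f"

definition intersection_lattice :: "'a set set \<Rightarrow> 'a set set"
  where "intersection_lattice D = {\<Inter>B | B. B \<subseteq> D}"

definition localization :: "'a set set \<Rightarrow> 'a set \<Rightarrow> 'a set set"
  where "localization D W = {H \<in> D. W \<subseteq> H}"

text \<open>Defining polynomials of \<open>D\<close> exist and are unique up to a nonzero scalar, on which
  the splitting condition in \<open>irreducible_arrangement\<close> does not depend.\<close>
definition defining_polynomial :: "(complex ^ 'n) set set \<Rightarrow> 'n::finite cpoly \<Rightarrow> bool"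
  where "defining_polynomial D q \<longleftrightarrow>
    (\<exists>l. (\<forall>H\<in>D. linear_poly (l H) \<and> H = zeros (l H)) \<and> q = (\<Prod>H\<in>D. l H))"

definition irreducible_arrangement :: "(complex ^ 'n::finite) set set \<Rightarrow> bool"
  where "irreducible_arrangement D \<longleftrightarrow> (\<exists>q. defining_polynomial D q \<and>
    \<not> (\<exists>A g h. invertible A \<and> lin_change A q = g * h \<and>
          vars g \<noteq> {} \<and> vars h \<noteq> {} \<and> vars g \<inter> vars h = {}))"

definition dense_edge :: "(complex ^ 'n::finite) set set \<Rightarrow> (complex ^ 'n) set \<Rightarrow> bool"
  where "dense_edge D W \<longleftrightarrow>
    W \<in> intersection_lattice D \<and> W \<noteq> UNIV \<and> irreducible_arrangement (localization D W)"

text \<open>\<open>vec.dim\<close> is the dimension over the complex numbers (\<open>dim\<close> would be the real one).\<close>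
definition edge_rank :: "(complex ^ 'n::finite) set \<Rightarrow> nat"
  where "edge_rank W = CARD('n) - vec.dim W"

definition edge_indices :: "(complex ^ 'n) set \<Rightarrow> ('r \<Rightarrow> 'n::finite cpoly) \<Rightarrow> 'r set"
  where "edge_indices W fs = {j. W \<subseteq> zeros (fs j)}"


section \<open>Partial derivatives of polynomials and rational functions\<close>

definition pd :: "'n \<Rightarrow> 'n cpoly \<Rightarrow> 'n cpoly"
  where "pd i p = (\<Sum>m\<in>Poly_Mapping.keys p. Poly_Mapping.single
    (m - Poly_Mapping.single i 1)
    (of_nat (Poly_Mapping.lookup m i) * Poly_Mapping.lookup p m))"

abbreviation pd_mono :: "'n \<Rightarrow> ('n \<Rightarrow>\<^sub>0 nat) \<Rightarrow> complex \<Rightarrow> 'n cpoly"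
  where "pd_mono i m c \<equiv>
    Poly_Mapping.single (m - Poly_Mapping.single i 1) (of_nat (Poly_Mapping.lookup m i) * c)"

lemma pd_superset:
  assumes "finite S" "Poly_Mapping.keys p \<subseteq> S"
  shows "pd i p = (\<Sum>m\<in>S. pd_mono i m (Poly_Mapping.lookup p m))"
  unfolding pd_def
  by (rule sum.mono_neutral_left) (use assms in \<open>auto simp: in_keys_iff\<close>)

lemma pd_add: "pd i (p + q) = pd i p + pd i q"
proof -
  let ?S = "Poly_Mapping.keys p \<union> Poly_Mapping.keys q"
  have "pd i (p + q) = (\<Sum>m\<in>?S. pd_mono i m (Poly_Mapping.lookup (p + q) m))"
    by (rule pd_superset) (auto simp: keys_add)
  also have "\<dots> = pd i p + pd i q"
    by (simp add: pd_superset[of ?S] lookup_add distrib_left single_add sum.distrib)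
  finally show ?thesis .
qed

lemma pd_zero [simp]: "pd i 0 = 0"
  by (simp add: pd_def)

lemma pd_single: "pd i (Poly_Mapping.single m c) = pd_mono i m c"
  by (subst pd_superset[of "{m}"]) auto

lemma pd_mult_single:
  fixes m n :: "'n \<Rightarrow>\<^sub>0 nat"
  shows "pd i (Poly_Mapping.single m c * Poly_Mapping.single n d) =
     pd i (Poly_Mapping.single m c) * Poly_Mapping.single n d +
     Poly_Mapping.single m c * pd i (Poly_Mapping.single n d)"
proof -
  let ?e = "Poly_Mapping.single i (1::nat)"
  have shift: "(k - ?e) + l = (k + l) - ?e" if "Poly_Mapping.lookup k i \<noteq> 0"
    for k l :: "'n \<Rightarrow>\<^sub>0 nat"
    using that by (intro poly_mapping_eqI) (auto simp: lookup_add lookup_minus lookup_single when_def)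
  have 1: "pd_mono i m c * Poly_Mapping.single n d =
      Poly_Mapping.single ((m + n) - ?e) (of_nat (Poly_Mapping.lookup m i) * (c * d))"
  proof (cases "Poly_Mapping.lookup m i = 0")
    case False
    then show ?thesis by (simp only: mult_single shift[OF False] mult.assoc)
  qed simp
  have 2: "Poly_Mapping.single m c * pd_mono i n d =
      Poly_Mapping.single ((m + n) - ?e) (of_nat (Poly_Mapping.lookup n i) * (c * d))"
  proof (cases "Poly_Mapping.lookup n i = 0")
    case False
    then show ?thesis using shift[OF False, of m]
      by (simp only: mult_single add.commute[of m] mult.left_commute)
  qed simp
  have "pd i (Poly_Mapping.single m c * Poly_Mapping.single n d) = pd_mono i (m + n) (c * d)"
    by (simp only: mult_single pd_single)
  then show ?thesis
    unfolding pd_single 1 2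
    by (simp add: lookup_add single_add[symmetric] distrib_right)
qed

lemma mpoly_induct [case_names zero step]:
  fixes p :: "('v, 'a::comm_monoid_add) mpoly"
  assumes "P 0" "\<And>p m c. P p \<Longrightarrow> P (Poly_Mapping.single m c + p)"
  shows "P p"
proof -
  have *: "P (\<Sum>m\<in>S. Poly_Mapping.single m (Poly_Mapping.lookup p m))" if "finite S" for S
    using that by induction (auto intro: assms)
  have "p = (\<Sum>m\<in>Poly_Mapping.keys p. Poly_Mapping.single m (Poly_Mapping.lookup p m))"
    by (rule poly_mapping_eqI)
      (auto simp: lookup_sum lookup_single when_def in_keys_iff)
  then show ?thesis using *[of "Poly_Mapping.keys p"] by simp
qed

lemma pd_mult: "pd i (p * q) = pd i p * q + p * pd i q"
proof (induction p rule: mpoly_induct)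
  case zero
  then show ?case by simp
next
  case (step p m c)
  have "pd i (Poly_Mapping.single m c * q) =
      pd i (Poly_Mapping.single m c) * q + Poly_Mapping.single m c * pd i q"
  proof (induction q rule: mpoly_induct)
    case zero
    then show ?case by simp
  next
    case (step q n d)
    then show ?case
      by (simp add: distrib_left pd_add pd_mult_single algebra_simps)
  qed
  then show ?case
    using step by (simp add: pd_add algebra_simps)
qed

text \<open>The extension of a derivation \<open>d\<close> of an integral domain to its fraction field, by the
  quotient rule; see \<open>fract_deriv_Fract\<close> for the independence of representatives.\<close>
definition fract_deriv :: "('a::idom \<Rightarrow> 'a) \<Rightarrow> 'a fract \<Rightarrow> 'a fract"
  where "fract_deriv d q =
    (THE r. \<exists>a b. b \<noteq> 0 \<and> q = Fract a b \<and> r = Fract (d a * b - a * d b) (b * b))"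

definition pd_fract :: "'n::linorder \<Rightarrow> 'n cpoly fract \<Rightarrow> 'n cpoly fract"
  where "pd_fract i = fract_deriv (pd i)"

lemma quotient_rule_respects:
  fixes a b c d :: "'a::idom"
  assumes "a * d = c * b" "a' * d + a * d' = c' * b + c * b'"
  shows "(a' * b - a * b') * (d * d) = (c' * d - c * d') * (b * b)"
  using assms by algebra

context
  fixes d :: "'a::idom \<Rightarrow> 'a"
  assumes d_add: "\<And>x y. d (x + y) = d x + d y"
    and d_mult: "\<And>x y. d (x * y) = d x * y + x * d y"
begin

lemma fract_deriv_Fract:
  assumes "b \<noteq> 0"
  shows "fract_deriv d (Fract a b) = Fract (d a * b - a * d b) (b * b)"
  unfolding fract_deriv_def
proof (rule the_equality)
  show "\<exists>a' b'. b' \<noteq> 0 \<and> Fract a b = Fract a' b' \<and>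
      Fract (d a * b - a * d b) (b * b) = Fract (d a' * b' - a' * d b') (b' * b')"
    using assms by blast
next
  fix r
  assume "\<exists>a' b'. b' \<noteq> 0 \<and> Fract a b = Fract a' b' \<and> r = Fract (d a' * b' - a' * d b') (b' * b')"
  then obtain a' b' where nz: "b' \<noteq> 0" and eq: "a * b' = a' * b"
    and r: "r = Fract (d a' * b' - a' * d b') (b' * b')"
    using assms by (auto simp: eq_fract)
  have "(d a * b - a * d b) * (b' * b') = (d a' * b' - a' * d b') * (b * b)"
    using quotient_rule_respects[OF eq] arg_cong[OF eq, of d] by (simp only: d_mult)
  then show "r = Fract (d a * b - a * d b) (b * b)"
    unfolding r using nz assms by (simp add: eq_fract)
qed

lemma fract_deriv_add: "fract_deriv d (x + y) = fract_deriv d x + fract_deriv d y"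
proof (cases x; cases y)
  fix a b a' b' assume *: "x = Fract a b" "b \<noteq> 0" "y = Fract a' b'" "b' \<noteq> 0"
  show ?thesis
    using *(2,4) unfolding *(1,3)
    by (simp add: fract_deriv_Fract d_add d_mult eq_fract) algebra
qed

lemma fract_deriv_mult: "fract_deriv d (x * y) = fract_deriv d x * y + x * fract_deriv d y"
proof (cases x; cases y)
  fix a b a' b' assume *: "x = Fract a b" "b \<noteq> 0" "y = Fract a' b'" "b' \<noteq> 0"
  show ?thesis
    using *(2,4) unfolding *(1,3)
    by (simp add: fract_deriv_Fract d_mult eq_fract) algebra
qed

lemma fract_deriv_zero: "fract_deriv d 0 = 0"
  using fract_deriv_add[of 0 0] by (metis add.right_neutral add_left_imp_eq)

end

lemma fract_deriv_commute:
  fixes d e :: "'a::idom \<Rightarrow> 'a"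
  assumes d: "\<And>x y. d (x + y) = d x + d y" "\<And>x y. d (x * y) = d x * y + x * d y"
    and e: "\<And>x y. e (x + y) = e x + e y" "\<And>x y. e (x * y) = e x * y + x * e y"
    and com: "\<And>x. d (e x) = e (d x)"
  shows "fract_deriv d (fract_deriv e x) = fract_deriv e (fract_deriv d x)"
    and "fract_deriv d (Fract (e p) p) = fract_deriv e (Fract (d p) p)"
proof -
  have dd: "d (x - y) = d x - d y" and ee: "e (x - y) = e x - e y" for x y
    using d(1)[of "x - y" y] e(1)[of "x - y" y] by (simp_all add: algebra_simps)
  show "fract_deriv d (fract_deriv e x) = fract_deriv e (fract_deriv d x)"
  proof (cases x)
    fix a b assume x: "x = Fract a b" and b: "b \<noteq> 0"
    show ?thesis
      using b unfolding x
      by (simp add: fract_deriv_Fract[OF d] fract_deriv_Fract[OF e] d e dd ee com eq_fract)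
        (simp add: algebra_simps)
  qed
  show "fract_deriv d (Fract (e p) p) = fract_deriv e (Fract (d p) p)"
  proof (cases "p = 0")
    case True
    then show ?thesis
      using fract_deriv_zero[OF d] fract_deriv_zero[OF e]
      by (simp add: eq_fract(2) flip: Zero_fract_def)
  next
    case False
    then show ?thesis
      by (simp add: fract_deriv_Fract[OF d] fract_deriv_Fract[OF e] com mult.commute)
  qed
qed

lemmas pd_fract_Fract = fract_deriv_Fract[where d = "pd i" for i, OF pd_add pd_mult, folded pd_fract_def]
lemmas pd_fract_add = fract_deriv_add[where d = "pd i" for i, OF pd_add pd_mult, folded pd_fract_def]
lemmas pd_fract_mult = fract_deriv_mult[where d = "pd i" for i, OF pd_add pd_mult, folded pd_fract_def]
lemmas pd_fract_zero = fract_deriv_zero[where d = "pd i" for i, OF pd_add pd_mult, folded pd_fract_def]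

lemma pd_commute: "pd i (pd j p) = pd j (pd i p)"
proof (induction p rule: mpoly_induct)
  case zero
  then show ?case by simp
next
  case (step p m c)
  have "pd i (pd j (Poly_Mapping.single m c)) = pd j (pd i (Poly_Mapping.single m c))"
  proof (cases "i = j")
    case False
    have shift: "m - Poly_Mapping.single j 1 - Poly_Mapping.single i 1 =
        m - Poly_Mapping.single i 1 - Poly_Mapping.single j (1::nat)"
      by (rule poly_mapping_eqI) (simp add: lookup_minus)
    have "Poly_Mapping.lookup (m - Poly_Mapping.single j 1) i = Poly_Mapping.lookup m i"
      "Poly_Mapping.lookup (m - Poly_Mapping.single i 1) j = Poly_Mapping.lookup m j"
      using False by (simp_all add: lookup_minus lookup_single)
    then show ?thesis
      by (simp only: pd_single shift mult.left_commute)
  qed simp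
  then show ?case using step by (simp add: pd_add)
qed

lemmas pd_fract_commute = fract_deriv_commute[where d = "pd i" and e = "pd j" for i j,
  OF pd_add pd_mult pd_add pd_mult pd_commute, folded pd_fract_def]


section \<open>The Bernstein-Sato ideal\<close>

text \<open>
  The element \<open>u(x,s) f\<^sup>s\<close> of the free rank one module \<open>C(x)[s] f\<^sup>s\<close> is represented by its
  coefficient \<open>u\<close>. In particular \<open>f\<^sup>s\<close> and \<open>f\<^sup>s\<^sup>+\<^sup>1\<close> are represented by \<open>1\<close> and
  \<open>\<Prod>j. f\<^sub>j\<close>. Starting from these elements only powers of \<open>f\<close> occur as denominators, so
  that everything takes place in the submodule \<open>C[x,1/f][s] f\<^sup>s\<close>.
\<close>
type_synonym ('n, 'r) smod = "('r, 'n cpoly fract) mpoly"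

text \<open>
  The operator \<open>\<Sum>\<beta>. p\<^sub>\<beta>(x,s) \<partial>\<^sup>\<beta>\<close> of \<open>D\<^sub>X[s]\<close>, which for \<open>X = C\<^sup>n\<close> is the Weyl algebra with
  \<open>s\<close> adjoined, is represented by its coefficients \<open>p\<^sub>\<beta>\<close> in \<open>C[x][s]\<close>, placed to the left of
  \<open>\<partial>\<^sup>\<beta>\<close>. The product of type \<open>poly_mapping\<close> is not the composition of operators and is not
  used here.
\<close>
type_synonym ('n, 'r) diffop = "('n \<Rightarrow>\<^sub>0 nat) \<Rightarrow>\<^sub>0 ('r, 'n cpoly) mpoly"

text \<open>\<open>\<partial>\<^sub>i (u f\<^sup>s) = (\<partial>\<^sub>i u + (\<Sum>j. s\<^sub>j (\<partial>\<^sub>i f\<^sub>j) / f\<^sub>j) u) f\<^sup>s\<close>\<close>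
definition pd_fs ::
    "('r::finite \<Rightarrow> 'n::{finite,linorder} cpoly) \<Rightarrow> 'n \<Rightarrow> ('n, 'r) smod \<Rightarrow> ('n, 'r) smod"
  where "pd_fs fs i u = Poly_Mapping.map (pd_fract i) u
    + (\<Sum>j\<in>UNIV. Var j * Const (Fract (pd i (fs j)) (fs j))) * u"

lemma map_add:
  assumes "\<And>x y. d (x + y) = d x + d y" "d 0 = 0"
  shows "Poly_Mapping.map d (p + q) = Poly_Mapping.map d p + Poly_Mapping.map d q"
  by (intro poly_mapping_eqI)
    (auto simp: Poly_Mapping.map.rep_eq lookup_add when_def assms simp flip: assms(1))

lemma map_zero [simp]: "Poly_Mapping.map d 0 = 0"
  by (intro poly_mapping_eqI) (simp add: Poly_Mapping.map.rep_eq)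

lemma map_derivation_mult:
  fixes d :: "'a::comm_ring_1 \<Rightarrow> 'a" and p q :: "('v, 'a) mpoly"
  assumes add: "\<And>x y. d (x + y) = d x + d y" and zero: "d 0 = 0"
    and mult: "\<And>x y. d (x * y) = d x * y + x * d y"
  shows "Poly_Mapping.map d (p * q) = Poly_Mapping.map d p * q + p * Poly_Mapping.map d q"
proof (induction p rule: mpoly_induct)
  case zero
  then show ?case by simp
next
  case (step p m a)
  have "Poly_Mapping.map d (Poly_Mapping.single m a * q) =
     Poly_Mapping.map d (Poly_Mapping.single m a) * q +
     Poly_Mapping.single m a * Poly_Mapping.map d q"
  proof (induction q rule: mpoly_induct)
    case zero
    then show ?case by simp
  next
    case (step q n b)
    then show ?case
      by (simp add: distrib_left map_add[OF add zero] map_single zero mult_single mult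
          single_add)
  qed
  then show ?case using step
    by (simp add: distrib_right map_add[OF add zero])
qed

lemma pd_fs_mult:
  "pd_fs fs i (v * u) = Poly_Mapping.map (pd_fract i) v * u + v * pd_fs fs i u"
  by (simp add: pd_fs_def algebra_simps
      map_derivation_mult[where d = "pd_fract i", OF pd_fract_add pd_fract_zero pd_fract_mult])

lemma pd_fs_commute: "pd_fs fs i (pd_fs fs j u) = pd_fs fs j (pd_fs fs i u)"
proof -
  let ?M = "\<lambda>i. Poly_Mapping.map (pd_fract i)"
  let ?w = "\<lambda>i. \<Sum>k\<in>UNIV. Var k * Const (Fract (pd i (fs k)) (fs k))"
  note add = map_add[where d = "pd_fract i" for i, OF pd_fract_add pd_fract_zero]
  note mult = map_derivation_mult[where d = "pd_fract i" for i,
      OF pd_fract_add pd_fract_zero pd_fract_mult]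
  have sum: "?M i (\<Sum>k\<in>S. g k) = (\<Sum>k\<in>S. ?M i (g k))"
    for i S and g :: "'a \<Rightarrow> ('b, 'a) smod"
    by (induction S rule: infinite_finite_induct) (simp_all add: add)
  have w: "?M i (?w j) = ?M j (?w i)"
    by (simp add: sum Var_def Const_def mult_single map_single pd_fract_zero pd_fract_commute(2)[of i j])
  have c: "?M i (?M j u) = ?M j (?M i u)"
  proof (rule poly_mapping_eqI)
    fix m
    have "pd_fract i (pd_fract j (Poly_Mapping.lookup u m)) =
        pd_fract j (pd_fract i (Poly_Mapping.lookup u m))"
      by (rule pd_fract_commute(1))
    then show "Poly_Mapping.lookup (?M i (?M j u)) m = Poly_Mapping.lookup (?M j (?M i u)) m"
      by (auto simp: Poly_Mapping.map.rep_eq when_def pd_fract_zero)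
  qed
  show ?thesis
    unfolding pd_fs_def add mult w c by (simp add: algebra_simps)
qed

text \<open>The operators \<open>pd_fs fs i\<close> commute (lemma \<open>pd_fs_commute\<close>), so the order in which
  they are applied is immaterial.\<close>
definition pd_fs_pow ::
    "('r::finite \<Rightarrow> 'n::{finite,linorder} cpoly) \<Rightarrow> ('n \<Rightarrow>\<^sub>0 nat) \<Rightarrow> ('n, 'r) smod \<Rightarrow> ('n, 'r) smod"
  where "pd_fs_pow fs \<beta> =
    fold (\<lambda>i. pd_fs fs i ^^ Poly_Mapping.lookup \<beta> i) (sorted_list_of_set UNIV)"

definition diffop_act ::
    "('r::finite \<Rightarrow> 'n::{finite,linorder} cpoly) \<Rightarrow> ('n, 'r) diffop \<Rightarrow> ('n, 'r) smod \<Rightarrow> ('n, 'r) smod"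
  where "diffop_act fs P u = (\<Sum>\<beta>\<in>Poly_Mapping.keys P.
    Poly_Mapping.map (\<lambda>p. Fract p 1) (Poly_Mapping.lookup P \<beta>) * pd_fs_pow fs \<beta> u)"

definition bernstein_sato_ideal ::
    "('r::finite \<Rightarrow> 'n::{finite,linorder} cpoly) \<Rightarrow> 'r cpoly set"
  where "bernstein_sato_ideal fs =
    {b. \<exists>P. Poly_Mapping.map (\<lambda>c. Fract (Const c) 1) b
              = diffop_act fs P (Const (Fract (\<Prod>j\<in>UNIV. fs j) 1))}"

definition zero_locus :: "'r::finite cpoly set \<Rightarrow> (complex ^ 'r) set"
  where "zero_locus B = {s. \<forall>b\<in>B. peval s b = 0}"

end

theory Submission
  imports Defs
begin

text \<open>
  Since \<open>b\<close> is polynomial, it suffices to treat a Zariski dense set of integral points \<open>\<alpha>\<close> of the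
  hyperplane; there \<open>b(\<alpha>) f\<^sup>\<alpha> = P(\<alpha>) f\<^sup>\<alpha>\<^sup>+\<^sup>1\<close> is an identity of rational functions. Choose
  forms \<open>l\<^sub>v\<close>, \<open>v \<in> S\<close>, among the \<open>f\<^sub>j\<close> with \<open>j \<in> J(W)\<close>, that are a basis of their span. Let the
  exponents of the \<open>l\<^sub>v\<close> be negative and all others nonnegative. The fractions that can be written
  as a sum of terms each having some \<open>l\<^sub>v\<close> not in the denominator form a \<open>D\<close>-submodule \<open>U\<close> (the
  quotient is local cohomology along \<open>W\<close>). As \<open>k < |J(W)|\<close>, counting degrees gives
  \<open>f\<^sup>\<alpha>\<^sup>+\<^sup>1 \<in> U\<close>, hence \<open>b(\<alpha>) l\<^sub>r\<^sup>k f\<^sup>\<alpha> \<in> U\<close>. Restricting to a transversal slice at a generic point of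
  \<open>W\<close>, this forces \<open>b(\<alpha>) = 0\<close> as soon as a certain coefficient of the product of the powers of the
  remaining forms in the basis \<open>l\<^sub>v\<close> is nonzero.

  Irreducibility says that the bipartite graph of forms and basis elements occurring in them is
  connected. Growing it from one basis element, a form or a basis element at a time, shows that the
  exponents with nonzero coefficient are dense.
\<close>

section \<open>Evaluation homomorphisms\<close>

text \<open>The exponents at the points used are \<open>- 1 - e v\<close> at the basis forms, with a
  further \<open>- k\<close> at one of them, and \<open>c j\<close> at the other forms of J(W),
  where the c j and the e v have equal sums. Since the basis has rank(W) elements, the sum over J(W)
  is - rank(W) - k: this is the hyperplane of the theorem. Transversally to W, the quotient by U
  lives in degrees at most - rank(W), with the class of 1/\<Prod> l_v on top. There f^(\<alpha>+1)
  has order |J(W)| - rank(W) - k, which exceeds - rank(W) exactly when k < |J(W)|. The factor l_r^k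
  moves f^\<alpha> to the top degree, where its class is read off from the coefficient of the
  monomial e in the product of the other forms. The obstacle is that this coefficient can vanish by
  cancellation at single points, so only density can be expected. Without irreducibility even
  density fails: if the forms split into blocks using disjoint basis elements, a nonzero coefficient
  forces equal sums of c and e in each block, and the exponents stay in a proper subspace.\<close>

definition insertion ::
    "('a::zero \<Rightarrow> 'b::comm_ring_1) \<Rightarrow> ('v::finite \<Rightarrow> 'b) \<Rightarrow> ('v, 'a) mpoly \<Rightarrow> 'b"
  where "insertion h g p = (\<Sum>m\<in>Poly_Mapping.keys p.
    h (Poly_Mapping.lookup p m) * (\<Prod>v\<in>UNIV. g v ^ Poly_Mapping.lookup m v))"

lemma insertion_superset:
  assumes "h 0 = 0" "finite M" "Poly_Mapping.keys p \<subseteq> M"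
  shows "insertion h g p =
    (\<Sum>m\<in>M. h (Poly_Mapping.lookup p m) * (\<Prod>v\<in>UNIV. g v ^ Poly_Mapping.lookup m v))"
  unfolding insertion_def
  by (rule sum.mono_neutral_left) (use assms in \<open>auto simp: in_keys_iff\<close>)

lemma insertion_zero [simp]: "insertion h g 0 = 0"
  by (simp add: insertion_def)

lemma insertion_single:
  "h 0 = 0 \<Longrightarrow> insertion h g (Poly_Mapping.single m c) =
    h c * (\<Prod>v\<in>UNIV. g v ^ Poly_Mapping.lookup m v)"
  by (subst insertion_superset[of h "{m}"]) auto

lemma insertion_map:
  assumes "h 0 = 0" "h' 0 = 0"
  shows "insertion h g (Poly_Mapping.map h' p) = insertion (\<lambda>c. h (h' c)) g p"
proof -
  have "Poly_Mapping.keys (Poly_Mapping.map h' p) \<subseteq> Poly_Mapping.keys p"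
    by (auto simp: in_keys_iff Poly_Mapping.map.rep_eq)
  then have "insertion h g (Poly_Mapping.map h' p) = (\<Sum>m\<in>Poly_Mapping.keys p.
      h (Poly_Mapping.lookup (Poly_Mapping.map h' p) m)
        * (\<Prod>v\<in>UNIV. g v ^ Poly_Mapping.lookup m v))"
    by (intro insertion_superset) (use assms in auto)
  then show ?thesis
    by (simp add: insertion_def Poly_Mapping.map.rep_eq in_keys_iff)
qed

lemma Const_mult_single: "Const c * Poly_Mapping.single m d = Poly_Mapping.single m (c * d)"
  by (simp add: Const_def mult_single)

lemma Var_power: "Var v ^ n = Poly_Mapping.single (Poly_Mapping.single v n) 1"
  by (induction n) (simp_all add: Var_def mult_single flip: single_add)

lemma Const_zero [simp]: "Const 0 = 0"
  by (simp add: Const_def)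

lemma Const_one [simp]: "Const 1 = 1"
  by (simp add: Const_def)

lemma Const_add: "Const (a + b) = Const a + Const (b::'a::monoid_add)"
  by (simp add: Const_def single_add)

lemma Const_mult: "Const (a * b) = Const a * Const (b::'a::comm_ring_1)"
  by (simp add: Const_def mult_single)

lemma Const_sum: "Const (sum h A) = (\<Sum>x\<in>A. Const (h x :: 'a::comm_monoid_add))"
  by (induction A rule: infinite_finite_induct) (simp_all add: Const_add)

lemma Const_power: "Const (a ^ n) = Const (a::'a::comm_ring_1) ^ n"
  by (induction n) (simp_all add: Const_mult)

lemma Const_eq_iff [simp]: "Const a = Const b \<longleftrightarrow> a = b"
  by (metis Const_def lookup_single_eq)

lemma Const_eq_zero_iff [simp]: "Const a = 0 \<longleftrightarrow> a = 0"
  by (metis Const_eq_iff Const_zero)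

lemma lookup_Const_mult: "Poly_Mapping.lookup (Const c * p) m = c * Poly_Mapping.lookup p m"
  for c :: "'a::comm_ring_1"
  by (induction p rule: mpoly_induct)
    (simp_all add: distrib_left Const_mult_single lookup_add lookup_single when_def)

text \<open>Evaluation at a point, linear changes of coordinates, specialization of s at integers
  and restriction to an affine slice are all values of \<open>insertion\<close>, so the homomorphism
  laws are proved once, for a ring homomorphism \<open>h\<close> on coefficients and arbitrary
  values \<open>g\<close> of the variables.\<close>

locale insertion_hom =
  fixes h :: "'a::comm_ring_1 \<Rightarrow> 'b::comm_ring_1" and g :: "'v::finite \<Rightarrow> 'b"
  assumes h_add: "h (x + y) = h x + h y" and h_mult: "h (x * y) = h x * h y" and h_one: "h 1 = 1"
begin

lemma h_zero: "h 0 = 0"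
  using h_add[of 0 0] by simp

lemma insertion_add: "insertion h g (p + q) = insertion h g p + insertion h g q"
proof -
  let ?M = "Poly_Mapping.keys p \<union> Poly_Mapping.keys q"
  have "insertion h g (p + q) = (\<Sum>m\<in>?M. h (Poly_Mapping.lookup (p + q) m)
      * (\<Prod>v\<in>UNIV. g v ^ Poly_Mapping.lookup m v))"
    by (rule insertion_superset) (auto simp: h_zero keys_add)
  then show ?thesis
    by (simp add: insertion_superset[of h ?M] h_zero lookup_add h_add distrib_right sum.distrib)
qed

lemma insertion_mult: "insertion h g (p * q) = insertion h g p * insertion h g q"
proof (induction p rule: mpoly_induct)
  case (step p m c)
  have "insertion h g (Poly_Mapping.single m c * q) =
      insertion h g (Poly_Mapping.single m c) * insertion h g q"
  proof (induction q rule: mpoly_induct)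
    case (step q n d)
    then show ?case
      by (simp add: distrib_left insertion_add insertion_single h_zero mult_single h_mult
          lookup_add power_add prod.distrib mult_ac)
  qed simp
  then show ?case
    using step by (simp add: distrib_right insertion_add)
qed simp

lemma insertion_Const: "insertion h g (Const c) = h c"
  by (simp add: Const_def insertion_single h_zero)

lemma insertion_Var: "insertion h g (Var w) = g w"
proof -
  have "insertion h g (Var w) = (\<Prod>v\<in>UNIV. g v ^ Poly_Mapping.lookup (Poly_Mapping.single w 1) v)"
    by (simp add: Var_def insertion_single h_zero h_one)
  also have "\<dots> = (\<Prod>v\<in>UNIV. if v = w then g v else 1)"
    by (intro prod.cong) (auto simp: lookup_single when_def)
  finally show ?thesis by simp
qed

lemma insertion_one: "insertion h g 1 = 1"
  using insertion_Const[of 1] by (simp add: h_one)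

lemma insertion_sum: "insertion h g (sum f A) = (\<Sum>x\<in>A. insertion h g (f x))"
  by (induction A rule: infinite_finite_induct) (simp_all add: insertion_add)

lemma insertion_prod: "insertion h g (prod f A) = (\<Prod>x\<in>A. insertion h g (f x))"
  by (induction A rule: infinite_finite_induct) (simp_all add: insertion_mult insertion_one)

lemma insertion_power: "insertion h g (p ^ n) = insertion h g p ^ n"
  by (induction n) (simp_all add: insertion_mult insertion_one)

lemmas insertion_simps = insertion_add insertion_mult insertion_Const insertion_Var insertion_one
  insertion_sum insertion_prod insertion_power

end

lemma peval_eq_insertion: "peval x = insertion (\<lambda>c. c) (\<lambda>v. x $ v)"
  by (intro ext) (simp add: peval_def insertion_def)

lemma lin_change_eq_insertion:
  "lin_change A = insertion Const (\<lambda>v. \<Sum>w\<in>UNIV. Const (A $ v $ w) * Var w)"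
  by (intro ext) (simp add: lin_change_def insertion_def)

interpretation peval: insertion_hom "\<lambda>c::complex. c" "\<lambda>v. x $ v"
  rewrites "insertion (\<lambda>c. c) (\<lambda>v. x $ v) = peval x"
  for x :: "complex ^ 'v::finite"
  by unfold_locales (simp_all add: peval_eq_insertion)

interpretation Const: insertion_hom "Const :: complex \<Rightarrow> 'w cpoly" g
  for g :: "'v::finite \<Rightarrow> 'w cpoly"
  by unfold_locales (simp_all add: Const_add Const_mult)

section \<open>Linear forms\<close>

definition linform :: "complex ^ 'n::finite \<Rightarrow> 'n cpoly"
  where "linform a = (\<Sum>v\<in>UNIV. Const (a $ v) * Var v)"

text \<open>Bilinear rather than Hermitian: the first argument is the coefficient vector of a form,
  the second a point.\<close>

definition pairing :: "complex ^ 'n::finite \<Rightarrow> complex ^ 'n \<Rightarrow> complex"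
  where "pairing a x = (\<Sum>v\<in>UNIV. a $ v * x $ v)"

lemma pairing_add_right: "pairing a (x + y) = pairing a x + pairing a y"
  by (simp add: pairing_def distrib_left sum.distrib)

lemma pairing_scale_right: "pairing a (c *s x) = c * pairing a x"
  by (simp add: pairing_def sum_distrib_left mult_ac)

lemma pairing_diff_right: "pairing a (x - y) = pairing a x - pairing a y"
  by (simp add: pairing_def right_diff_distrib sum_subtractf)

lemma pairing_zero_right [simp]: "pairing a 0 = 0"
  by (simp add: pairing_def)

lemma pairing_add_left: "pairing (a + b) x = pairing a x + pairing b x"
  by (simp add: pairing_def distrib_right sum.distrib)

lemma pairing_scale_left: "pairing (c *s a) x = c * pairing a x"
  by (simp add: pairing_def sum_distrib_left mult_ac)

lemma pairing_zero_left [simp]: "pairing 0 x = 0"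
  by (simp add: pairing_def)

lemma pairing_sum_left: "pairing (sum f A) x = (\<Sum>i\<in>A. pairing (f i) x)"
  by (induction A rule: infinite_finite_induct) (simp_all add: pairing_add_left)

lemma pairing_axis [simp]: "pairing a (axis v 1) = a $ v"
  by (simp add: pairing_def axis_def if_distrib cong: if_cong)

lemma peval_linform: "peval x (linform a) = pairing a x"
  by (simp add: linform_def pairing_def peval.insertion_simps)

lemma linform_add: "linform (a + b) = linform a + linform b"
  by (simp add: linform_def Const_add distrib_right sum.distrib)

lemma linform_scale: "linform (c *s a) = Const c * linform a"
  by (simp add: linform_def Const_mult sum_distrib_left mult_ac)

lemma linform_zero [simp]: "linform 0 = 0"
  by (simp add: linform_def)

lemma linform_sum: "linform (sum f A) = (\<Sum>i\<in>A. linform (f i))"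
  by (induction A rule: infinite_finite_induct) (simp_all add: linform_add)

text \<open>Substitution acts on coefficient vectors by the transposed matrix: the new coefficients
  are the values of the form at the columns of \<open>A\<close>. A matrix whose columns are dual to
  given forms therefore turns these forms into variables.\<close>

lemma lin_change_linform:
  "lin_change A (linform a) = linform (\<chi> w. pairing a (\<chi> v. A $ v $ w))"
  unfolding linform_def lin_change_eq_insertion pairing_def
  by (simp add: Const.insertion_simps Const_sum Const_mult sum_distrib_left sum_distrib_right mult_ac)
    (rule sum.swap)

lemma mdegree_eq: "mdegree m = (\<Sum>v\<in>UNIV. Poly_Mapping.lookup m (v::'v::finite))"
  unfolding mdegree_def by (rule sum.mono_neutral_left) (auto simp: in_keys_iff)

lemma mdegree_add: "mdegree (m + n) = mdegree m + mdegree (n :: 'v::finite \<Rightarrow>\<^sub>0 nat)"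
  by (simp add: mdegree_eq lookup_add sum.distrib)

lemma mdegree_zero_iff [simp]: "mdegree m = 0 \<longleftrightarrow> m = (0 :: 'v::finite \<Rightarrow>\<^sub>0 nat)"
  by (auto simp: mdegree_eq intro!: poly_mapping_eqI)

lemma mdegree_single [simp]: "mdegree (Poly_Mapping.single v n) = n"
  by (simp add: mdegree_def)

lemma mdegree_one_cases:
  fixes m :: "'v::finite \<Rightarrow>\<^sub>0 nat"
  assumes "mdegree m = 1"
  obtains v where "m = Poly_Mapping.single v 1"
proof -
  have "(\<Sum>v\<in>UNIV. Poly_Mapping.lookup m v) = 1"
    using assms by (simp add: mdegree_eq)
  then obtain v where "Poly_Mapping.lookup m v = 1" "\<forall>w. w \<noteq> v \<longrightarrow> Poly_Mapping.lookup m w = 0"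
    by (auto simp: sum_eq_Suc0_iff)
  then have "m = Poly_Mapping.single v 1"
    by (intro poly_mapping_eqI) (auto simp: lookup_single when_def)
  then show thesis by (rule that)
qed

lemma single_eq_iff_nat: "Poly_Mapping.single v (1::nat) = Poly_Mapping.single w 1 \<longleftrightarrow> v = w"
  by (metis lookup_single_eq lookup_single_not_eq zero_neq_one)

lemma lookup_linform:
  "Poly_Mapping.lookup (linform a) m =
    (\<Sum>v\<in>UNIV. if m = Poly_Mapping.single v 1 then a $ v else 0)"
  by (auto simp: linform_def lookup_sum Var_def Const_mult_single lookup_single when_def
      intro!: sum.cong)

lemma lookup_linform_single: "Poly_Mapping.lookup (linform a) (Poly_Mapping.single v 1) = a $ v"
  unfolding lookup_linform single_eq_iff_nat by simp

lemma lookup_linform_other: "mdegree m \<noteq> 1 \<Longrightarrow> Poly_Mapping.lookup (linform a) m = 0"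
  unfolding lookup_linform by (rule sum.neutral) auto

text \<open>The constant term has to be kept, because \<open>central_arrangement\<close> asks for
  homogeneity of the product and not of the single \<open>l H\<close>. A homogeneous
  \<open>p\<close> has none, as it contains a monomial of degree one.\<close>

lemma linear_polyE:
  fixes p :: "'n::finite cpoly"
  assumes "linear_poly p"
  obtains c a where "a \<noteq> 0" "p = Const c + linform a" "homogeneous p \<longrightarrow> c = 0"
proof -
  define c where "c = Poly_Mapping.lookup p 0"
  define a where "a = (\<chi> v. Poly_Mapping.lookup p (Poly_Mapping.single v 1))"
  from assms have le: "mdegree m \<le> 1" if "m \<in> Poly_Mapping.keys p" for m
    using that by (auto simp: linear_poly_def)
  from assms obtain m where m: "m \<in> Poly_Mapping.keys p" "mdegree m = 1"
    by (auto simp: linear_poly_def)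
  from m(2) obtain v where v: "m = Poly_Mapping.single v 1"
    by (rule mdegree_one_cases)
  have "a $ v \<noteq> 0"
    using m v by (simp add: a_def in_keys_iff)
  then have "a \<noteq> 0" by auto
  moreover have "p = Const c + linform a"
  proof (rule poly_mapping_eqI)
    fix n :: "'n \<Rightarrow>\<^sub>0 nat"
    consider "n = 0" | "mdegree n = 1" | "mdegree n > 1"
      using mdegree_zero_iff[of n] by linarith
    then show "Poly_Mapping.lookup p n = Poly_Mapping.lookup (Const c + linform a) n"
    proof cases
      case 1
      then show ?thesis by (simp add: lookup_add lookup_linform_other Const_def c_def mdegree_def)
    next
      case 2
      then obtain w where w: "n = Poly_Mapping.single w 1"
        by (rule mdegree_one_cases)
      have "n \<noteq> 0" using 2 by (auto simp: mdegree_def)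
      then show ?thesis
        using w by (simp add: lookup_add lookup_linform_single[simplified] Const_def a_def lookup_single when_def)
    next
      case 3
      then have "n \<notin> Poly_Mapping.keys p" using le by force
      moreover have "n \<noteq> 0" using 3 by (auto simp: mdegree_def)
      ultimately show ?thesis using 3
        by (simp add: lookup_add lookup_linform_other Const_def in_keys_iff lookup_single when_def)
    qed
  qed
  moreover have "homogeneous p \<longrightarrow> c = 0"
  proof
    assume "homogeneous p"
    then obtain d where d: "\<forall>m\<in>Poly_Mapping.keys p. mdegree m = d"
      by (auto simp: homogeneous_def)
    with m have "0 \<notin> Poly_Mapping.keys p" by (force simp: mdegree_def)
    then show "c = 0" by (simp add: c_def in_keys_iff)
  qed
  ultimately show thesis by (rule that)
qed

section \<open>Coefficients of products of linear forms\<close>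

lemma lookup_single_mult_add:
  fixes p :: "('v, complex) mpoly"
  shows "Poly_Mapping.lookup (Poly_Mapping.single m 1 * p) (m + e) = Poly_Mapping.lookup p e"
  by (induction p rule: mpoly_induct)
    (simp_all add: distrib_left lookup_add mult_single lookup_single when_def)

lemma lookup_single_mult_nle:
  fixes p :: "('v, complex) mpoly"
  assumes "Poly_Mapping.lookup e v < Poly_Mapping.lookup m v"
  shows "Poly_Mapping.lookup (Poly_Mapping.single m 1 * p) e = 0"
proof -
  have ne: "m + n \<noteq> e" for n
    using assms by (auto simp: lookup_add)
  show ?thesis
    by (induction p rule: mpoly_induct)
      (simp_all add: distrib_left lookup_add mult_single lookup_single when_def ne)
qed

definition var_degree_le :: "'v \<Rightarrow> nat \<Rightarrow> ('v, 'a::zero) mpoly \<Rightarrow> bool"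
  where "var_degree_le v d p \<longleftrightarrow> (\<forall>m\<in>Poly_Mapping.keys p. Poly_Mapping.lookup m v \<le> d)"

lemma var_degree_leD: "var_degree_le v d p \<Longrightarrow> d < Poly_Mapping.lookup m v \<Longrightarrow> Poly_Mapping.lookup p m = 0"
  by (force simp: var_degree_le_def in_keys_iff)

lemma var_degree_le_mult:
  fixes p q :: "('v, 'a::comm_ring_1) mpoly"
  shows "var_degree_le v d p \<Longrightarrow> var_degree_le v d' q \<Longrightarrow> var_degree_le v (d + d') (p * q)"
  unfolding var_degree_le_def using keys_mult[of p q] by (fastforce simp: lookup_add intro: add_mono)

lemma var_degree_le_one [simp]: "var_degree_le v 0 (1 :: ('v, 'a::comm_ring_1) mpoly)"
  by (simp add: var_degree_le_def)

lemma var_degree_le_power: "var_degree_le v 0 p \<Longrightarrow> var_degree_le v 0 (p ^ n)"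
  for p :: "('v, 'a::comm_ring_1) mpoly"
  by (induction n) (use var_degree_le_mult[of v 0 p 0] in auto)

lemma var_degree_le_prod:
  "(\<And>x. x \<in> A \<Longrightarrow> var_degree_le v 0 (p x)) \<Longrightarrow> var_degree_le v 0 (\<Prod>x\<in>A. p x)"
  for p :: "'i \<Rightarrow> ('v, 'a::comm_ring_1) mpoly"
  by (induction A rule: infinite_finite_induct) (use var_degree_le_mult[of v 0 _ 0] in auto)

lemma ex_var_degree_le: "\<exists>d. var_degree_le v d p"
  unfolding var_degree_le_def
  by (rule exI[of _ "\<Sum>m\<in>Poly_Mapping.keys p. Poly_Mapping.lookup m v"])
    (auto intro: member_le_sum)

text \<open>\<open>C\<close> holds the coordinates of the forms in the basis, and
  \<open>Var v\<close> stands for the basis form l_v. Summing over \<open>S\<close> only amounts to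
  setting the other variables to zero, so \<open>S\<close> can grow later while \<open>C\<close>
  stays fixed.\<close>

definition row_form :: "('j \<Rightarrow> 'v \<Rightarrow> complex) \<Rightarrow> 'v set \<Rightarrow> 'j \<Rightarrow> 'v cpoly"
  where "row_form C S j = (\<Sum>v\<in>S. Const (C j v) * Var v)"

lemma var_degree_le_row_form:
  assumes "v \<notin> S \<or> C j v = 0"
  shows "var_degree_le v 0 (row_form C S j)"
proof -
  have "Poly_Mapping.lookup (row_form C S j) m = 0" if m: "0 < Poly_Mapping.lookup m v" for m
  proof -
    have "Poly_Mapping.lookup (Const (C j w) * Var w) m = 0" if "w \<in> S" for w
      using that assms m by (cases "w = v") (auto simp: Var_def Const_mult_single lookup_single when_def)
    then show ?thesis by (simp add: row_form_def lookup_sum)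
  qed
  then show ?thesis by (force simp: var_degree_le_def in_keys_iff)
qed

definition form_product ::
    "('j \<Rightarrow> 'v \<Rightarrow> complex) \<Rightarrow> 'j set \<Rightarrow> 'v set \<Rightarrow> ('j \<Rightarrow> nat) \<Rightarrow> 'v cpoly"
  where "form_product C J S c = (\<Prod>j\<in>J. row_form C S j ^ c j)"

lemma choose_eq_poly: "\<exists>p. \<forall>n. poly p (of_nat n :: complex) = of_nat (n choose k)"
proof (intro exI allI)
  fix n
  show "poly (smult (1 / fact k) (\<Prod>i=0..<k. [:- of_nat i, 1:])) (of_nat n :: complex)
      = of_nat (n choose k)"
    by (simp add: binomial_gbinomial gbinomial_prod_rev poly_prod)
qed

text \<open>The coefficient is a nonzero polynomial in \<open>n\<close> times \<open>a ^ n\<close>: for \<open>n = 0\<close> it is the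
  given nonzero coefficient of \<open>G\<close>.\<close>
lemma finite_vanishing_coefficients:
  fixes G L :: "'v cpoly" and e :: "'v \<Rightarrow>\<^sub>0 nat"
  assumes "Poly_Mapping.lookup G e \<noteq> 0" "a \<noteq> 0" "var_degree_le v 0 L"
  shows "finite {n. Poly_Mapping.lookup (G * (Const a * Var v + L) ^ n) (e + Poly_Mapping.single v n) = 0}"
proof -
  obtain d where d: "var_degree_le v d G"
    using ex_var_degree_le[of v G] by (elim exE)
  \<comment> \<open>In the binomial expansion the term with \<open>L ^ N\<close> takes the exponent
    n - N of v from the other factors, so \<open>G * L ^ N\<close> has to supply the monomial e
    times v^N. As \<open>L\<close> is free of v, this requires N \<le> d.\<close>
  define h where "h N = Poly_Mapping.lookup (G * L ^ N) (e + Poly_Mapping.single v N)" for N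
  have h0: "h N = 0" if "d < N" for N
  proof -
    have "var_degree_le v (d + 0) (G * L ^ N)"
      by (intro var_degree_le_mult d var_degree_le_power assms)
    then show ?thesis unfolding h_def
      by (rule var_degree_leD) (use that in \<open>simp add: lookup_add\<close>)
  qed
  have coeff: "Poly_Mapping.lookup (G * (Const a * Var v + L) ^ n) (e + Poly_Mapping.single v n)
      = a ^ n * (\<Sum>N\<le>d. of_nat (n choose N) * (h N / a ^ N))" for n
  proof -
    have "G * (Const a * Var v + L) ^ n
        = (\<Sum>N\<le>n. Const (of_nat (n choose N) * a ^ (n - N))
            * (Poly_Mapping.single (Poly_Mapping.single v (n - N)) 1 * (G * L ^ N)))"
    proof -
      have "G * (L + Const a * Var v) ^ n = (\<Sum>N\<le>n. G * (of_nat (n choose N) * L ^ N * (Const a * Var v) ^ (n - N)))"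
        by (simp add: binomial_ring sum_distrib_left)
      also have "\<dots> = (\<Sum>N\<le>n. Const (of_nat (n choose N) * a ^ (n - N))
            * (Poly_Mapping.single (Poly_Mapping.single v (n - N)) 1 * (G * L ^ N)))"
      proof (rule sum.cong[OF refl])
        fix N
        have "(of_nat k :: 'v cpoly) = Const (of_nat k)" for k
          by (simp add: Const_def)
        then show "G * (of_nat (n choose N) * L ^ N * (Const a * Var v) ^ (n - N))
          = Const (of_nat (n choose N) * a ^ (n - N))
            * (Poly_Mapping.single (Poly_Mapping.single v (n - N)) 1 * (G * L ^ N))"
          by (simp only: power_mult_distrib Const_mult Const_power flip: Var_power) (simp only: mult_ac)
      qed
      finally show ?thesis by (simp only: add.commute)
    qed
    then have "Poly_Mapping.lookup (G * (Const a * Var v + L) ^ n) (e + Poly_Mapping.single v n)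
        = (\<Sum>N\<le>n. of_nat (n choose N) * a ^ (n - N) *
            Poly_Mapping.lookup (Poly_Mapping.single (Poly_Mapping.single v (n - N)) 1 * (G * L ^ N))
              (e + Poly_Mapping.single v n))"
      by (simp add: lookup_sum lookup_Const_mult)
    also have "\<dots> = (\<Sum>N\<le>n. a ^ n * (of_nat (n choose N) * (h N / a ^ N)))"
    proof (rule sum.cong[OF refl])
      fix N assume N: "N \<in> {..n}"
      have "e + Poly_Mapping.single v n
          = Poly_Mapping.single v (n - N) + (e + Poly_Mapping.single v N)"
        using N by (simp add: add.left_commute flip: single_add)
      then have "Poly_Mapping.lookup (Poly_Mapping.single (Poly_Mapping.single v (n - N)) 1 * (G * L ^ N))
              (e + Poly_Mapping.single v n) = h N"
        by (simp only: lookup_single_mult_add h_def)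
      moreover have "a ^ (n - N) = a ^ n / a ^ N"
        using N assms(2) by (simp add: power_diff)
      ultimately show "of_nat (n choose N) * a ^ (n - N) *
            Poly_Mapping.lookup (Poly_Mapping.single (Poly_Mapping.single v (n - N)) 1 * (G * L ^ N))
              (e + Poly_Mapping.single v n) = a ^ n * (of_nat (n choose N) * (h N / a ^ N))"
        by simp
    qed
    \<comment> \<open>The range of summation has to become independent of n: beyond n the binomial
      coefficients vanish, beyond d the \<open>h N\<close>.\<close>
    also have "\<dots> = (\<Sum>N\<le>max n d. a ^ n * (of_nat (n choose N) * (h N / a ^ N)))"
      by (rule sum.mono_neutral_left) (auto simp: binomial_eq_0)
    also have "\<dots> = (\<Sum>N\<le>d. a ^ n * (of_nat (n choose N) * (h N / a ^ N)))"
      by (rule sum.mono_neutral_right) (auto simp: h0)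
    finally show ?thesis by (simp add: sum_distrib_left)
  qed
  obtain q where q: "\<And>k n. poly (q k) (of_nat n :: complex) = of_nat (n choose k)"
    using choose_eq_poly by metis
  define Q where "Q = (\<Sum>N\<le>d. smult (h N / a ^ N) (q N))"
  have Q: "poly Q (of_nat n) = (\<Sum>N\<le>d. of_nat (n choose N) * (h N / a ^ N))" for n
    by (simp add: Q_def poly_sum q mult.commute)
  have "poly Q (of_nat 0) = (\<Sum>N\<le>d. if N = 0 then h 0 else 0)"
    unfolding Q by (intro sum.cong) (auto simp: binomial_eq_0)
  also have "\<dots> \<noteq> 0"
    using assms(1) by (simp add: h_def)
  finally have "Q \<noteq> 0" by auto
  then have "finite (of_nat -` {x::complex. poly Q x = 0})"
    by (intro finite_vimageI poly_roots_finite) (simp_all add: inj_on_def)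
  moreover have "{n. Poly_Mapping.lookup (G * (Const a * Var v + L) ^ n) (e + Poly_Mapping.single v n) = 0}
      = of_nat -` {x::complex. poly Q x = 0}"
    using assms(2) by (auto simp: coeff Q)
  ultimately show ?thesis by simp
qed

text \<open>Here v occurs in one factor only, so all its n powers come from choosing
  \<open>Const a * Var v\<close> exactly n times and a single binomial term survives. If a is
  nonzero, no n is exceptional.\<close>

lemma lookup_mult_new_variable:
  fixes G L :: "'v cpoly" and e :: "'v \<Rightarrow>\<^sub>0 nat"
  assumes G: "var_degree_le v 0 G" and L: "var_degree_le v 0 L" and e: "Poly_Mapping.lookup e v = 0"
  shows "Poly_Mapping.lookup (G * (Const a * Var v + L) ^ (c + n)) (e + Poly_Mapping.single v n)
    = of_nat ((c + n) choose n) * a ^ n * Poly_Mapping.lookup (G * L ^ c) e"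
proof -
  let ?e = "e + Poly_Mapping.single v n"
  have "G * (Const a * Var v + L) ^ (c + n)
      = (\<Sum>k\<le>c + n. Const (of_nat ((c + n) choose k) * a ^ k)
          * (Poly_Mapping.single (Poly_Mapping.single v k) 1 * (G * L ^ (c + n - k))))"
  proof -
    have "G * (Const a * Var v + L) ^ (c + n)
        = (\<Sum>k\<le>c + n. G * (of_nat ((c + n) choose k) * (Const a * Var v) ^ k * L ^ (c + n - k)))"
      by (simp add: binomial_ring sum_distrib_left)
    also have "\<dots> = (\<Sum>k\<le>c + n. Const (of_nat ((c + n) choose k) * a ^ k)
          * (Poly_Mapping.single (Poly_Mapping.single v k) 1 * (G * L ^ (c + n - k))))"
    proof (rule sum.cong[OF refl])
      fix k
      have "(of_nat k :: 'v cpoly) = Const (of_nat k)" for k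
        by (simp add: Const_def)
      then show "G * (of_nat ((c + n) choose k) * (Const a * Var v) ^ k * L ^ (c + n - k))
        = Const (of_nat ((c + n) choose k) * a ^ k)
          * (Poly_Mapping.single (Poly_Mapping.single v k) 1 * (G * L ^ (c + n - k)))"
        by (simp only: power_mult_distrib Const_mult Const_power flip: Var_power) (simp only: mult_ac)
    qed
    finally show ?thesis .
  qed
  then have "Poly_Mapping.lookup (G * (Const a * Var v + L) ^ (c + n)) ?e
      = (\<Sum>k\<le>c + n. of_nat ((c + n) choose k) * a ^ k *
          Poly_Mapping.lookup (Poly_Mapping.single (Poly_Mapping.single v k) 1 * (G * L ^ (c + n - k))) ?e)"
    by (simp add: lookup_sum lookup_Const_mult)
  also have "\<dots> = (\<Sum>k\<le>c + n. if k = n then of_nat ((c + n) choose n) * a ^ n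
      * Poly_Mapping.lookup (G * L ^ c) e else 0)"
  proof (rule sum.cong[OF refl])
    fix k
    consider "k < n" | "k = n" | "n < k" by linarith
    then show "of_nat ((c + n) choose k) * a ^ k *
          Poly_Mapping.lookup (Poly_Mapping.single (Poly_Mapping.single v k) 1 * (G * L ^ (c + n - k))) ?e
        = (if k = n then of_nat ((c + n) choose n) * a ^ n * Poly_Mapping.lookup (G * L ^ c) e else 0)"
    proof cases
      case 1
      have "var_degree_le v (0 + 0) (G * L ^ (c + n - k))"
        by (intro var_degree_le_mult G var_degree_le_power L)
      then have "Poly_Mapping.lookup (G * L ^ (c + n - k)) (e + Poly_Mapping.single v (n - k)) = 0"
        by (rule var_degree_leD) (use 1 in \<open>simp add: lookup_add\<close>)
      moreover have "?e = Poly_Mapping.single v k + (e + Poly_Mapping.single v (n - k))"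
        using 1 by (simp add: add.left_commute flip: single_add)
      ultimately show ?thesis
        using 1 by (simp only: lookup_single_mult_add) simp
    next
      case 2
      then show ?thesis
        using lookup_single_mult_add[of "Poly_Mapping.single v n" "G * L ^ c" e] by (simp add: add.commute)
    next
      case 3
      have "Poly_Mapping.lookup (Poly_Mapping.single (Poly_Mapping.single v k) 1 * (G * L ^ (c + n - k))) ?e = 0"
        by (rule lookup_single_mult_nle[of _ v]) (use 3 e in \<open>simp add: lookup_add\<close>)
      then show ?thesis using 3 by simp
    qed
  qed
  finally show ?thesis by simp
qed

section \<open>Density of the exponents with nonzero coefficient\<close>

text \<open>Being polynomial on every affine line is all that is used of polynomial functions below.\<close>
definition pol_on_lines :: "(('j \<Rightarrow> complex) \<Rightarrow> ('v \<Rightarrow> complex) \<Rightarrow> complex) \<Rightarrow> bool"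
  where "pol_on_lines \<phi> \<longleftrightarrow>
    (\<forall>c c' e e'. \<exists>p. \<forall>t. \<phi> (\<lambda>j. c j + t * c' j) (\<lambda>v. e v + t * e' v) = poly p t)"

lemma pol_on_lines_zero:
  assumes "pol_on_lines \<phi>"
    and "infinite {n::nat. \<phi> (\<lambda>j. c j + of_nat n * c' j) (\<lambda>v. e v + of_nat n * e' v) = 0}"
  shows "\<phi> (\<lambda>j. c j + t * c' j) (\<lambda>v. e v + t * e' v) = 0"
proof -
  obtain p where p: "\<And>t. \<phi> (\<lambda>j. c j + t * c' j) (\<lambda>v. e v + t * e' v) = poly p t"
    using assms(1) unfolding pol_on_lines_def by meson
  have "p = 0"
  proof (rule ccontr)
    assume "p \<noteq> 0"
    then have "finite (of_nat -` {x. poly p x = 0} :: nat set)"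
      by (intro finite_vimageI poly_roots_finite) (simp_all add: inj_on_def)
    with assms(2) show False by (simp add: p vimage_def)
  qed
  then show ?thesis by (simp add: p)
qed

lemma pol_on_lines_translate:
  assumes "pol_on_lines \<phi>"
  shows "pol_on_lines (\<lambda>c e. \<phi> (\<lambda>j. c j + c0 j) (\<lambda>v. e v + e0 v))"
  unfolding pol_on_lines_def
proof (intro allI)
  fix c c' e e'
  obtain p where "\<forall>t. \<phi> (\<lambda>j. (c j + c0 j) + t * c' j) (\<lambda>v. (e v + e0 v) + t * e' v) = poly p t"
    using assms unfolding pol_on_lines_def by meson
  then show "\<exists>p. \<forall>t. \<phi> (\<lambda>j. c j + t * c' j + c0 j) (\<lambda>v. e v + t * e' v + e0 v) = poly p t"
    by (intro exI[of _ p]) (simp add: algebra_simps)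
qed

text \<open>Zariski density, in the space of all (c, e) with equal sums, of the natural points at
  which the monomial e occurs in the product of the forms with exponents c. Homogeneity forces the
  equality of the sums. Points of C^J x C^S are represented by total functions vanishing outside
  \<open>J\<close> and \<open>S\<close>.\<close>

definition support_dense :: "('j \<Rightarrow> 'v \<Rightarrow> complex) \<Rightarrow> 'j set \<Rightarrow> 'v set \<Rightarrow> bool"
  where "support_dense C J S \<longleftrightarrow> (\<forall>\<phi>. pol_on_lines \<phi> \<longrightarrow>
    (\<forall>(c :: 'j \<Rightarrow> nat) (e :: 'v \<Rightarrow>\<^sub>0 nat). (\<forall>j. j \<notin> J \<longrightarrow> c j = 0) \<longrightarrow> Poly_Mapping.keys e \<subseteq> S \<longrightarrow>
      (\<Sum>j\<in>J. c j) = (\<Sum>v\<in>S. Poly_Mapping.lookup e v) \<longrightarrow>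
      Poly_Mapping.lookup (form_product C J S c) e \<noteq> 0 \<longrightarrow>
      \<phi> (\<lambda>j. of_nat (c j)) (\<lambda>v. of_nat (Poly_Mapping.lookup e v)) = 0) \<longrightarrow>
    (\<forall>c e. (\<forall>j. j \<notin> J \<longrightarrow> c j = 0) \<longrightarrow> (\<forall>v. v \<notin> S \<longrightarrow> e v = 0) \<longrightarrow>
      (\<Sum>j\<in>J. c j) = (\<Sum>v\<in>S. e v) \<longrightarrow> \<phi> c e = 0))"

lemma support_denseI:
  assumes "\<And>\<phi> c e. pol_on_lines \<phi> \<Longrightarrow>
    (\<And>(c :: 'j \<Rightarrow> nat) (e :: 'v \<Rightarrow>\<^sub>0 nat). (\<And>j. j \<notin> J \<Longrightarrow> c j = 0) \<Longrightarrow> Poly_Mapping.keys e \<subseteq> S \<Longrightarrow>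
      (\<Sum>j\<in>J. c j) = (\<Sum>v\<in>S. Poly_Mapping.lookup e v) \<Longrightarrow>
      Poly_Mapping.lookup (form_product C J S c) e \<noteq> 0 \<Longrightarrow>
      \<phi> (\<lambda>j. of_nat (c j)) (\<lambda>v. of_nat (Poly_Mapping.lookup e v)) = 0) \<Longrightarrow>
    (\<And>j. j \<notin> J \<Longrightarrow> c j = 0) \<Longrightarrow> (\<And>v. v \<notin> S \<Longrightarrow> e v = 0) \<Longrightarrow>
      (\<Sum>j\<in>J. c j) = (\<Sum>v\<in>S. e v) \<Longrightarrow> \<phi> c e = 0"
  shows "support_dense C J S"
  unfolding support_dense_def by (intro allI impI, rule assms) auto

lemma support_denseD:
  fixes J :: "'j set" and S :: "'v set"
  assumes "support_dense C J S" "pol_on_lines \<phi>"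
    and "\<And>(c :: 'j \<Rightarrow> nat) (e :: 'v \<Rightarrow>\<^sub>0 nat). (\<And>j. j \<notin> J \<Longrightarrow> c j = 0) \<Longrightarrow> Poly_Mapping.keys e \<subseteq> S \<Longrightarrow>
      (\<Sum>j\<in>J. c j) = (\<Sum>v\<in>S. Poly_Mapping.lookup e v) \<Longrightarrow>
      Poly_Mapping.lookup (form_product C J S c) e \<noteq> 0 \<Longrightarrow>
      \<phi> (\<lambda>j. of_nat (c j)) (\<lambda>v. of_nat (Poly_Mapping.lookup e v)) = 0"
    and "\<And>j. j \<notin> J \<Longrightarrow> c j = 0" "\<And>v. v \<notin> S \<Longrightarrow> e v = 0" "(\<Sum>j\<in>J. c j) = (\<Sum>v\<in>S. e v)"
  shows "\<phi> c e = 0"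
  using assms(1)[unfolded support_dense_def, rule_format, OF assms(2)] assms(3-6) by metis

text \<open>The empty product is 1, and equality of the sums forces \<open>e r = 0\<close>, so the
  space of parameters is the single point 0, where the coefficient is 1.\<close>

lemma support_dense_base:
  fixes C :: "'a \<Rightarrow> 'b \<Rightarrow> complex"
  shows "support_dense C {} {r}"
proof (rule support_denseI)
  fix \<phi> :: "('a \<Rightarrow> complex) \<Rightarrow> ('b \<Rightarrow> complex) \<Rightarrow> complex" and c :: "'a \<Rightarrow> complex" and e :: "'b \<Rightarrow> complex"
  assume van: "\<And>(c :: 'a \<Rightarrow> nat) (e :: 'b \<Rightarrow>\<^sub>0 nat). (\<And>j. j \<notin> {} \<Longrightarrow> c j = 0) \<Longrightarrow> Poly_Mapping.keys e \<subseteq> {r} \<Longrightarrow>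
      (\<Sum>j\<in>{}. c j) = (\<Sum>v\<in>{r}. Poly_Mapping.lookup e v) \<Longrightarrow>
      Poly_Mapping.lookup (form_product C {} {r} c) e \<noteq> 0 \<Longrightarrow>
      \<phi> (\<lambda>j. of_nat (c j)) (\<lambda>v. of_nat (Poly_Mapping.lookup e v)) = 0"
    and c: "\<And>j. j \<notin> {} \<Longrightarrow> c j = 0" and e: "\<And>v. v \<notin> {r} \<Longrightarrow> e v = 0"
    and s: "(\<Sum>j\<in>{}. c j) = (\<Sum>v\<in>{r}. e v)"
  have "c = (\<lambda>_. 0)" using c by auto
  moreover have "e v = 0" for v
    using e s by (cases "v = r") auto
  then have "e = (\<lambda>_. 0)" by (rule ext)
  ultimately show "\<phi> c e = 0"
    using van[of "\<lambda>_. 0" 0] by (simp add: form_product_def)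
qed

lemma sum_delta_smult:
  fixes x :: "'a::comm_semiring_1"
  assumes "finite A" "i \<in> A"
  shows "(\<Sum>k\<in>A. g k + x * (if k = i then 1 else 0)) = (\<Sum>k\<in>A. g k) + x"
  using assms by (simp only: sum.distrib sum_distrib_left[symmetric] sum.delta) simp

text \<open>Every new point is an old one plus x times the direction that raises the exponents of
  the form j and of the basis element i together, with x = c j. Along this direction a nonzero old
  coefficient stays nonzero for all but finitely many natural steps, so \<phi> vanishes on the whole
  line, and density of the old points applies.\<close>

lemma support_dense_insert_form:
  fixes J :: "'j set" and S :: "'v set"
  assumes dense: "support_dense C J S" and fin: "finite J" "finite S"
    and j: "j \<notin> J" and i: "i \<in> S" "C j i \<noteq> 0"
  shows "support_dense C (insert j J) S"
proof (rule support_denseI)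
  fix \<phi> :: "('j \<Rightarrow> complex) \<Rightarrow> ('v \<Rightarrow> complex) \<Rightarrow> complex" and c :: "'j \<Rightarrow> complex" and e :: "'v \<Rightarrow> complex"
  assume pol: "pol_on_lines \<phi>"
    and van: "\<And>(c :: 'j \<Rightarrow> nat) (e :: 'v \<Rightarrow>\<^sub>0 nat). (\<And>j'. j' \<notin> insert j J \<Longrightarrow> c j' = 0) \<Longrightarrow>
      Poly_Mapping.keys e \<subseteq> S \<Longrightarrow> (\<Sum>j\<in>insert j J. c j) = (\<Sum>v\<in>S. Poly_Mapping.lookup e v) \<Longrightarrow>
      Poly_Mapping.lookup (form_product C (insert j J) S c) e \<noteq> 0 \<Longrightarrow>
      \<phi> (\<lambda>j. of_nat (c j)) (\<lambda>v. of_nat (Poly_Mapping.lookup e v)) = 0"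
    and c: "\<And>j'. j' \<notin> insert j J \<Longrightarrow> c j' = 0" and e: "\<And>v. v \<notin> S \<Longrightarrow> e v = 0"
    and sum: "(\<Sum>j\<in>insert j J. c j) = (\<Sum>v\<in>S. e v)"
  define dj :: "'j \<Rightarrow> complex" where "dj k = (if k = j then 1 else 0)" for k
  define di :: "'v \<Rightarrow> complex" where "di k = (if k = i then 1 else 0)" for k
  define x where "x = c j"
  \<comment> \<open>As x is a complex number, the old density is applied to the translate of \<phi>
    by x times the direction.\<close>
  have "\<phi> (\<lambda>k. (c k - x * dj k) + x * dj k) (\<lambda>v. (e v - x * di v) + x * di v) = 0"
  proof (rule support_denseD[OF dense,
        where \<phi> = "\<lambda>c e. \<phi> (\<lambda>k. c k + x * dj k) (\<lambda>v. e v + x * di v)"])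
    show "pol_on_lines (\<lambda>c e. \<phi> (\<lambda>k. c k + x * dj k) (\<lambda>v. e v + x * di v))"
      by (rule pol_on_lines_translate[OF pol])
  next
    fix c :: "'j \<Rightarrow> nat" and e :: "'v \<Rightarrow>\<^sub>0 nat"
    assume c: "\<And>j'. j' \<notin> J \<Longrightarrow> c j' = 0" and e: "Poly_Mapping.keys e \<subseteq> S"
      and sum: "(\<Sum>j\<in>J. c j) = (\<Sum>v\<in>S. Poly_Mapping.lookup e v)"
      and nz: "Poly_Mapping.lookup (form_product C J S c) e \<noteq> 0"
    have split: "row_form C S j = Const (C j i) * Var i + row_form C (S - {i}) j"
      using i fin by (simp add: row_form_def sum.remove)
    define Z where "Z = {n. Poly_Mapping.lookup (form_product C J S c * row_form C S j ^ n)
        (e + Poly_Mapping.single i n) = 0}"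
    have "finite Z"
      unfolding Z_def split
      by (rule finite_vanishing_coefficients[OF nz i(2)]) (rule var_degree_le_row_form, simp)
    have "\<phi> (\<lambda>k. of_nat (c k) + of_nat n * dj k)
        (\<lambda>v. of_nat (Poly_Mapping.lookup e v) + of_nat n * di v) = 0" if n: "n \<notin> Z" for n
    proof -
      have "\<phi> (\<lambda>k. of_nat ((c(j := n)) k))
          (\<lambda>v. of_nat (Poly_Mapping.lookup (e + Poly_Mapping.single i n) v)) = 0"
      proof (rule van)
        show "(c(j := n)) j' = 0" if "j' \<notin> insert j J" for j'
          using that c by simp
        show "Poly_Mapping.keys (e + Poly_Mapping.single i n) \<subseteq> S"
          using e i keys_add[of e "Poly_Mapping.single i n"] by (auto split: if_splits)
        have "(\<Sum>k\<in>J. (c(j := n)) k) = (\<Sum>k\<in>J. c k)"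
          using j by (intro sum.cong) auto
        moreover have "(\<Sum>v\<in>S. Poly_Mapping.lookup (e + Poly_Mapping.single i n) v)
            = (\<Sum>v\<in>S. Poly_Mapping.lookup e v) + n"
          using sum_delta_smult[OF fin(2) i(1), of "Poly_Mapping.lookup e" n]
          by (simp add: lookup_add lookup_single when_def if_distrib eq_commute cong: if_cong)
        ultimately show "(\<Sum>k\<in>insert j J. (c(j := n)) k)
            = (\<Sum>v\<in>S. Poly_Mapping.lookup (e + Poly_Mapping.single i n) v)"
          using fin j sum by simp
        have "form_product C (insert j J) S (c(j := n)) = form_product C J S c * row_form C S j ^ n"
        proof -
          have "(\<Prod>k\<in>J. row_form C S k ^ (c(j := n)) k) = form_product C J S c"
            unfolding form_product_def by (intro prod.cong) (use j in auto)
          then show ?thesis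
            using fin j by (simp add: form_product_def mult.commute)
        qed
        then show "Poly_Mapping.lookup (form_product C (insert j J) S (c(j := n)))
            (e + Poly_Mapping.single i n) \<noteq> 0"
          using n by (simp add: Z_def)
      qed
      moreover have "(\<lambda>k. of_nat ((c(j := n)) k)) = (\<lambda>k. of_nat (c k) + of_nat n * dj k)"
        using c[OF j] by (auto simp: dj_def)
      moreover have "(\<lambda>v. of_nat (Poly_Mapping.lookup (e + Poly_Mapping.single i n) v))
          = (\<lambda>v. of_nat (Poly_Mapping.lookup e v) + of_nat n * di v)"
        by (auto simp: di_def lookup_add lookup_single when_def)
      ultimately show ?thesis by metis
    qed
    then have "- Z \<subseteq> {n. \<phi> (\<lambda>k. of_nat (c k) + of_nat n * dj k)
        (\<lambda>v. of_nat (Poly_Mapping.lookup e v) + of_nat n * di v) = 0}"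
      by auto
    moreover have "infinite (- Z)"
      using \<open>finite Z\<close> by (metis finite_compl infinite_UNIV_nat)
    ultimately show "\<phi> (\<lambda>k. of_nat (c k) + x * dj k)
        (\<lambda>v. of_nat (Poly_Mapping.lookup e v) + x * di v) = 0"
      by (intro pol_on_lines_zero[OF pol]) (meson infinite_super)
  next
    show "c j' - x * dj j' = 0" if "j' \<notin> J" for j'
      using that c[of j'] by (auto simp: dj_def x_def)
    show "e v - x * di v = 0" if "v \<notin> S" for v
      using that e[of v] i by (auto simp: di_def)
    have "(\<Sum>k\<in>J. c k - x * dj k) = (\<Sum>k\<in>J. c k)"
      using j by (intro sum.cong) (auto simp: dj_def)
    moreover have "(\<Sum>v\<in>S. e v - x * di v) = (\<Sum>v\<in>S. e v) - x"
      using sum_delta_smult[OF fin(2) i(1), of e "- x"] by (simp add: di_def cong: if_cong)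
    moreover have "x + (\<Sum>k\<in>J. c k) = (\<Sum>v\<in>S. e v)"
      using sum fin j by (simp add: x_def)
    ultimately show "(\<Sum>k\<in>J. c k - x * dj k) = (\<Sum>v\<in>S. e v - x * di v)"
      by (metis add_diff_cancel_left')
  qed
  then show "\<phi> c e = 0" by simp
qed

text \<open>The new variable v occurs in the form j alone. The exponents of j and v are raised
  together by n, and \<open>lookup_mult_new_variable\<close> shows that the coefficient stays
  nonzero for every n.\<close>

lemma support_dense_insert_variable:
  fixes J :: "'j set" and S :: "'v set"
  assumes dense: "support_dense C J S" and fin: "finite J" "finite S"
    and v: "v \<notin> S" and j: "j \<in> J" "C j v \<noteq> 0" and uniq: "\<And>k. k \<in> J \<Longrightarrow> k \<noteq> j \<Longrightarrow> C k v = 0"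
  shows "support_dense C J (insert v S)"
proof (rule support_denseI)
  fix \<phi> :: "('j \<Rightarrow> complex) \<Rightarrow> ('v \<Rightarrow> complex) \<Rightarrow> complex" and c :: "'j \<Rightarrow> complex" and e :: "'v \<Rightarrow> complex"
  assume pol: "pol_on_lines \<phi>"
    and van: "\<And>(c :: 'j \<Rightarrow> nat) (e :: 'v \<Rightarrow>\<^sub>0 nat). (\<And>j'. j' \<notin> J \<Longrightarrow> c j' = 0) \<Longrightarrow>
      Poly_Mapping.keys e \<subseteq> insert v S \<Longrightarrow> (\<Sum>j\<in>J. c j) = (\<Sum>v\<in>insert v S. Poly_Mapping.lookup e v) \<Longrightarrow>
      Poly_Mapping.lookup (form_product C J (insert v S) c) e \<noteq> 0 \<Longrightarrow>
      \<phi> (\<lambda>j. of_nat (c j)) (\<lambda>v. of_nat (Poly_Mapping.lookup e v)) = 0"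
    and c: "\<And>j'. j' \<notin> J \<Longrightarrow> c j' = 0" and e: "\<And>w. w \<notin> insert v S \<Longrightarrow> e w = 0"
    and sum: "(\<Sum>j\<in>J. c j) = (\<Sum>w\<in>insert v S. e w)"
  define dj :: "'j \<Rightarrow> complex" where "dj k = (if k = j then 1 else 0)" for k
  define dv :: "'v \<Rightarrow> complex" where "dv k = (if k = v then 1 else 0)" for k
  define x where "x = e v"
  have "\<phi> (\<lambda>k. (c k - x * dj k) + x * dj k) (\<lambda>w. (e w - x * dv w) + x * dv w) = 0"
  proof (rule support_denseD[OF dense,
        where \<phi> = "\<lambda>c e. \<phi> (\<lambda>k. c k + x * dj k) (\<lambda>v. e v + x * dv v)"])
    show "pol_on_lines (\<lambda>c e. \<phi> (\<lambda>k. c k + x * dj k) (\<lambda>v. e v + x * dv v))"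
      by (rule pol_on_lines_translate[OF pol])
  next
    fix c :: "'j \<Rightarrow> nat" and e :: "'v \<Rightarrow>\<^sub>0 nat"
    assume c: "\<And>j'. j' \<notin> J \<Longrightarrow> c j' = 0" and e: "Poly_Mapping.keys e \<subseteq> S"
      and sum: "(\<Sum>j\<in>J. c j) = (\<Sum>v\<in>S. Poly_Mapping.lookup e v)"
      and nz: "Poly_Mapping.lookup (form_product C J S c) e \<noteq> 0"
    have ev: "Poly_Mapping.lookup e v = 0"
      using e v by (auto simp: in_keys_iff)
    have "\<phi> (\<lambda>k. of_nat (c k) + of_nat n * dj k)
        (\<lambda>v. of_nat (Poly_Mapping.lookup e v) + of_nat n * dv v) = 0" for n
    proof -
      let ?c = "c(j := c j + n)" and ?e = "e + Poly_Mapping.single v n"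
      have "\<phi> (\<lambda>k. of_nat (?c k)) (\<lambda>v. of_nat (Poly_Mapping.lookup ?e v)) = 0"
      proof (rule van)
        show "?c j' = 0" if "j' \<notin> J" for j'
          using that c j by auto
        show "Poly_Mapping.keys ?e \<subseteq> insert v S"
          using e keys_add[of e "Poly_Mapping.single v n"] by (auto split: if_splits)
        have "(\<Sum>w\<in>S. Poly_Mapping.lookup ?e w) = (\<Sum>w\<in>S. Poly_Mapping.lookup e w)"
          by (intro sum.cong) (use v in \<open>auto simp: lookup_add lookup_single when_def\<close>)
        moreover have "(\<Sum>k\<in>J. ?c k) = (\<Sum>k\<in>J. c k) + n"
          using sum_delta_smult[OF fin(1) j(1), of c n] by (auto simp: if_distrib intro!: sum.cong elim!: trans[rotated])
        ultimately show "(\<Sum>k\<in>J. ?c k) = (\<Sum>w\<in>insert v S. Poly_Mapping.lookup ?e w)"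
          using fin v ev sum by (simp add: lookup_add)
        define G where "G = (\<Prod>k\<in>J - {j}. row_form C S k ^ c k)"
        have form: "row_form C (insert v S) k = Const (C k v) * Var v + row_form C S k" for k
          using fin v by (simp add: row_form_def)
        have "form_product C J (insert v S) ?c
            = row_form C (insert v S) j ^ ?c j * (\<Prod>k\<in>J - {j}. row_form C (insert v S) k ^ ?c k)"
          unfolding form_product_def using fin(1) j(1) by (rule prod.remove)
        also have "(\<Prod>k\<in>J - {j}. row_form C (insert v S) k ^ ?c k) = G"
          unfolding G_def by (intro prod.cong) (use uniq in \<open>auto simp: form\<close>)
        finally have 1: "form_product C J (insert v S) ?c
            = G * (Const (C j v) * Var v + row_form C S j) ^ (c j + n)"
          unfolding form fun_upd_same by (simp only: mult.commute)
        have 2: "form_product C J S c = G * row_form C S j ^ c j"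
          unfolding form_product_def G_def using fin(1) j(1) by (simp add: prod.remove mult.commute)
        have "var_degree_le v 0 G"
          unfolding G_def by (intro var_degree_le_prod var_degree_le_power var_degree_le_row_form) (use v in auto)
        then have "Poly_Mapping.lookup (form_product C J (insert v S) ?c) ?e
            = of_nat ((c j + n) choose n) * C j v ^ n * Poly_Mapping.lookup (form_product C J S c) e"
          unfolding 1 2 by (rule lookup_mult_new_variable) (use v ev in \<open>auto intro: var_degree_le_row_form\<close>)
        then show "Poly_Mapping.lookup (form_product C J (insert v S) ?c) ?e \<noteq> 0"
          using nz j by simp
      qed
      moreover have "(\<lambda>k. of_nat (?c k)) = (\<lambda>k. of_nat (c k) + of_nat n * dj k)"
        by (auto simp: dj_def)
      moreover have "(\<lambda>v. of_nat (Poly_Mapping.lookup ?e v))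
          = (\<lambda>v. of_nat (Poly_Mapping.lookup e v) + of_nat n * dv v)"
        by (auto simp: dv_def lookup_add lookup_single when_def)
      ultimately show ?thesis by metis
    qed
    then show "\<phi> (\<lambda>k. of_nat (c k) + x * dj k)
        (\<lambda>v. of_nat (Poly_Mapping.lookup e v) + x * dv v) = 0"
      by (intro pol_on_lines_zero[OF pol]) simp
  next
    show "c j' - x * dj j' = 0" if "j' \<notin> J" for j'
      using that c[of j'] j by (auto simp: dj_def)
    show "e w - x * dv w = 0" if "w \<notin> S" for w
      using that e[of w] by (auto simp: dv_def x_def)
    have "(\<Sum>w\<in>S. e w - x * dv w) = (\<Sum>w\<in>S. e w)"
      using v by (intro sum.cong) (auto simp: dv_def)
    moreover have "(\<Sum>k\<in>J. c k - x * dj k) = (\<Sum>k\<in>J. c k) - x"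
      using sum_delta_smult[OF fin(1) j(1), of c "- x"] by (simp add: dj_def cong: if_cong)
    ultimately show "(\<Sum>k\<in>J. c k - x * dj k) = (\<Sum>w\<in>S. e w - x * dv w)"
      using sum fin v by (simp add: x_def)
  qed
  then show "\<phi> c e = 0" by simp
qed

lemma support_dense_insert_forms:
  assumes "finite K" "support_dense C J S" "finite J" "finite S" "J \<inter> K = {}"
    and "\<And>j. j \<in> K \<Longrightarrow> \<exists>v\<in>S. C j v \<noteq> 0"
  shows "support_dense C (J \<union> K) S"
  using assms
proof (induction K)
  case (insert j K)
  then show ?case
    using support_dense_insert_form[of C "J \<union> K" S j] by auto
qed simp

lemma support_dense_insert_variables:
  assumes "finite T" "support_dense C J S" "finite J" "finite S" "S \<inter> T = {}" "j \<in> J"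
    and "\<And>v. v \<in> T \<Longrightarrow> C j v \<noteq> 0" "\<And>k v. k \<in> J \<Longrightarrow> k \<noteq> j \<Longrightarrow> v \<in> T \<Longrightarrow> C k v = 0"
  shows "support_dense C J (S \<union> T)"
  using assms
proof (induction T)
  case (insert v T)
  then show ?case
    using support_dense_insert_variable[of C J "S \<union> T" v j] by auto
qed simp

text \<open>The invariant is that the forms in \<open>K\<close> involve no basis element of
  \<open>S - T\<close>. A form meeting both \<open>T\<close> and \<open>S - T\<close> is therefore
  not yet in \<open>K\<close>. It is adjoined before its basis elements outside \<open>T\<close>;
  these then occur in no other form present, as \<open>support_dense_insert_variable\<close>
  requires. Once \<open>T = S\<close>, every remaining form meets \<open>T\<close>.\<close>

lemma support_dense_connected:
  assumes fin: "finite J" "finite S" and r: "r \<in> S"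
    and row: "\<And>j. j \<in> J \<Longrightarrow> \<exists>v\<in>S. C j v \<noteq> 0"
    and conn: "\<And>T. T \<noteq> {} \<Longrightarrow> T \<subset> S \<Longrightarrow> \<exists>j\<in>J. (\<exists>v\<in>T. C j v \<noteq> 0) \<and> (\<exists>v\<in>S - T. C j v \<noteq> 0)"
  shows "support_dense C J S"
proof -
  have "support_dense C J S" if "K \<subseteq> J" "T \<subseteq> S" "T \<noteq> {}" "support_dense C K T"
      "\<And>k v. k \<in> K \<Longrightarrow> v \<in> S - T \<Longrightarrow> C k v = 0" for K T
    using that
  proof (induction "card (S - T)" arbitrary: K T rule: less_induct)
    case less
    have finK: "finite K" and finT: "finite T"
      using less.prems fin by (auto intro: finite_subset)
    show ?case
    proof (cases "T = S")
      case True
      then have "support_dense C (K \<union> (J - K)) S"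
        using less.prems fin finK row by (intro support_dense_insert_forms) auto
      then show ?thesis
        using less.prems by (simp add: Un_absorb1)
    next
      case False
      then obtain j where j: "j \<in> J" "\<exists>v\<in>T. C j v \<noteq> 0" "\<exists>v\<in>S - T. C j v \<noteq> 0"
        using conn[of T] less.prems by blast
      then have "j \<notin> K" using less.prems(5) by blast
      define N where "N = {v \<in> S - T. C j v \<noteq> 0}"
      have finN: "finite N" using fin by (simp add: N_def)
      from j \<open>j \<notin> K\<close> have "support_dense C (insert j K) T"
        using support_dense_insert_form[OF less.prems(4) finK finT] by blast
      then have "support_dense C (insert j K) (T \<union> N)"
        by (rule support_dense_insert_variables[OF finN, where j = j])
          (use finK finT less.prems(5) in \<open>auto simp: N_def\<close>)
      moreover have "card (S - (T \<union> N)) < card (S - T)"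
        by (rule psubset_card_mono) (use fin j(3) in \<open>auto simp: N_def\<close>)
      moreover have "C k v = 0" if "k \<in> insert j K" "v \<in> S - (T \<union> N)" for k v
        using that less.prems(5) by (auto simp: N_def)
      moreover have "insert j K \<subseteq> J" "T \<union> N \<subseteq> S" "T \<union> N \<noteq> {}"
        using less.prems(1-3) j(1) by (auto simp: N_def)
      ultimately show ?thesis
        by (intro less.hyps[of "T \<union> N" "insert j K"])
    qed
  qed
  from this[of "{}" "{r}"] show ?thesis
    using r support_dense_base[of C r] by simp
qed

section \<open>Specialization of the parameters\<close>

abbreviation emb :: "'n::linorder cpoly \<Rightarrow> 'n cpoly fract"
  where "emb p \<equiv> Fract p 1"

lemma emb_add: "emb (p + q) = emb p + emb q"
  by simp

lemma emb_mult: "emb (p * q) = emb p * emb q"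
  by simp

lemma emb_zero: "emb 0 = 0"
  by (simp add: Zero_fract_def)

lemma emb_one: "emb 1 = 1"
  by (simp add: One_fract_def)

lemma emb_eq_iff: "emb p = emb q \<longleftrightarrow> p = q"
  by (simp add: eq_fract)

lemma emb_eq_zero_iff: "emb p = 0 \<longleftrightarrow> p = 0"
  by (metis emb_eq_iff emb_zero)

lemma emb_sum: "emb (sum f A) = (\<Sum>x\<in>A. emb (f x))"
  by (induction A rule: infinite_finite_induct) (simp_all only: sum.infinite sum.empty sum.insert emb_zero emb_add not_False_eq_True)

lemma emb_prod: "emb (prod f A) = (\<Prod>x\<in>A. emb (f x))"
  by (induction A rule: infinite_finite_induct) (simp_all only: prod.infinite prod.empty prod.insert emb_one emb_mult not_False_eq_True)

lemma emb_power: "emb (p ^ n) = emb p ^ n"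
  by (induction n) (simp_all only: power_0 power_Suc emb_one emb_mult)

lemma emb_of_nat: "emb (of_nat n) = of_nat n"
  by (induction n) (simp_all only: of_nat_0 of_nat_Suc emb_zero emb_one emb_add)

lemma emb_uminus: "emb (- p) = - emb p"
  by simp

lemma emb_of_int: "emb (of_int z) = of_int z"
  by (cases z rule: int_cases2) (simp_all only: of_int_minus of_int_of_nat_eq emb_uminus emb_of_nat)

lemma Const_prod: "Const (prod h A) = (\<Prod>x\<in>A. Const (h x :: 'a::comm_ring_1))"
  by (induction A rule: infinite_finite_induct) (simp_all add: Const_mult)

lemma Const_of_int: "Const (of_int z :: complex) = of_int z"
  by (simp add: Const_def)

lemma Fract_eq_divide: "b \<noteq> 0 \<Longrightarrow> Fract a b = emb a / emb b"
  by (simp add: divide_inverse)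

lemma pd_Const: "pd i (Const c) = 0"
  by (simp add: Const_def pd_single)

lemma pd_one: "pd i 1 = 0"
  using pd_Const[of i 1] by simp

lemma pd_fract_emb: "pd_fract i (emb p) = emb (pd i p)"
  by (simp add: pd_fract_Fract pd_one)

lemma pd_of_int: "pd i (of_int z) = 0"
  by (simp add: pd_Const flip: Const_of_int)

lemma pd_fract_sum: "pd_fract i (sum f A) = (\<Sum>x\<in>A. pd_fract i (f x))"
  by (induction A rule: infinite_finite_induct) (simp_all add: pd_fract_zero pd_fract_add)

lemma pd_fract_of_int: "pd_fract i (of_int z) = 0"
  by (simp only: pd_fract_emb pd_of_int emb_zero flip: emb_of_int)

lemma pd_fract_one: "pd_fract i 1 = 0"
  using pd_fract_of_int[of i 1] by simp

lemma pd_fract_power: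
  assumes "u \<noteq> 0"
  shows "pd_fract i (u ^ n) = of_nat n * (pd_fract i u / u) * u ^ n"
  using assms by (induction n) (simp_all add: pd_fract_one pd_fract_mult field_simps)

lemma pd_fract_inverse:
  assumes "u \<noteq> 0"
  shows "pd_fract i (inverse u) = - (pd_fract i u / u) * inverse u"
proof -
  have "pd_fract i u * inverse u + u * pd_fract i (inverse u) = 0"
    using pd_fract_mult[of i u "inverse u"] assms by (simp add: pd_fract_one)
  then show ?thesis
    using assms by (simp add: field_simps eq_neg_iff_add_eq_0)
qed

lemma pd_fract_power_int:
  assumes "u \<noteq> 0"
  shows "pd_fract i (u powi z) = of_int z * (pd_fract i u / u) * u powi z"
proof (cases z rule: int_cases2)
  case (nonneg n)
  then show ?thesis using assms by (simp add: pd_fract_power)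
next
  case (nonpos n)
  have "u ^ n \<noteq> 0" using assms by simp
  from pd_fract_inverse[OF this, of i] show ?thesis
    using assms nonpos by (simp add: pd_fract_power power_int_minus)
qed

text \<open>At an integral point the formal symbol f^s becomes this rational function, and u f^s
  becomes \<open>spec \<alpha> u * fpow fs \<alpha>\<close>.\<close>

definition fpow :: "('r::finite \<Rightarrow> 'n::{finite,linorder} cpoly) \<Rightarrow> ('r \<Rightarrow> int) \<Rightarrow> 'n cpoly fract"
  where "fpow fs \<alpha> = (\<Prod>j\<in>UNIV. emb (fs j) powi \<alpha> j)"

lemma pd_fract_fpow:
  assumes nz: "\<And>j. fs j \<noteq> 0"
  shows "pd_fract i (fpow fs \<alpha>)
    = (\<Sum>j\<in>UNIV. of_int (\<alpha> j) * Fract (pd i (fs j)) (fs j)) * fpow fs \<alpha>"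
proof -
  have "pd_fract i (\<Prod>j\<in>A. emb (fs j) powi \<alpha> j)
      = (\<Sum>j\<in>A. of_int (\<alpha> j) * Fract (pd i (fs j)) (fs j)) * (\<Prod>j\<in>A. emb (fs j) powi \<alpha> j)"
    if "finite A" for A
    using that
  proof induction
    case (insert j A)
    have "pd_fract i (emb (fs j) powi \<alpha> j)
        = of_int (\<alpha> j) * Fract (pd i (fs j)) (fs j) * emb (fs j) powi \<alpha> j"
      using nz[of j] by (simp only: pd_fract_power_int emb_eq_zero_iff pd_fract_emb Fract_eq_divide not_False_eq_True)
    then show ?case
      unfolding prod.insert[OF insert(1,2)] sum.insert[OF insert(1,2)] pd_fract_mult insert(3)
      by (simp only: algebra_simps)
  qed (simp add: pd_fract_one)
  then show ?thesis by (simp add: fpow_def)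
qed

definition spec :: "('r::finite \<Rightarrow> int) \<Rightarrow> ('n::{finite,linorder}, 'r) smod \<Rightarrow> 'n cpoly fract"
  where "spec \<alpha> = insertion (\<lambda>c. c) (\<lambda>j. of_int (\<alpha> j))"

interpretation spec: insertion_hom "\<lambda>c :: 'n::{finite,linorder} cpoly fract. c" "\<lambda>j. of_int (\<alpha> j)"
  rewrites "insertion (\<lambda>c. c) (\<lambda>j. of_int (\<alpha> j)) = spec \<alpha>"
  for \<alpha> :: "'r::finite \<Rightarrow> int"
  by unfold_locales (simp_all add: spec_def)

lemma pd_fract_mult_const: "pd_fract i k = 0 \<Longrightarrow> pd_fract i (u * k) = pd_fract i u * k"
  by (simp add: pd_fract_mult)

lemma spec_pd_fract: "spec \<alpha> (Poly_Mapping.map (pd_fract i) u) = pd_fract i (spec \<alpha> u)"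
proof -
  have "pd_fract i (\<Prod>v\<in>UNIV. of_int (\<alpha> v) ^ Poly_Mapping.lookup m v) = 0" for m
    using pd_fract_of_int[of i "\<Prod>v\<in>UNIV. \<alpha> v ^ Poly_Mapping.lookup m v"]
    by (simp only: of_int_prod of_int_power)
  then show ?thesis
    unfolding spec_def
    by (subst insertion_map) (simp_all add: pd_fract_zero insertion_def pd_fract_sum pd_fract_mult_const)
qed

text \<open>Specialization at integers commutes with derivatives: the logarithmic derivative of
  f^\<alpha> is the sum of those of the f_j with weights \<open>\<alpha> j\<close>, which is the
  specialized multiplier of \<open>pd_fs\<close>.\<close>

lemma spec_pd_fs:
  assumes "\<And>j. fs j \<noteq> 0"
  shows "spec \<alpha> (pd_fs fs i u) * fpow fs \<alpha> = pd_fract i (spec \<alpha> u * fpow fs \<alpha>)"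
  unfolding pd_fs_def pd_fract_mult pd_fract_fpow[OF assms] spec.insertion_simps spec_pd_fract
  by (simp only: algebra_simps)

text \<open>The coefficients of an operator become polynomials in x. Which ones does not matter, as
  submodules are closed under multiplication by all polynomials.\<close>

lemma spec_map_emb: "\<exists>q. spec \<alpha> (Poly_Mapping.map (\<lambda>p. Fract p 1) u) = emb q"
proof -
  have "spec \<alpha> (Poly_Mapping.map (\<lambda>p. Fract p 1) u) = insertion emb (\<lambda>j. of_int (\<alpha> j)) u"
    unfolding spec_def by (rule insertion_map) (simp_all only: emb_zero)
  also have "\<dots> = emb (insertion (\<lambda>c. c) (\<lambda>j. of_int (\<alpha> j)) u)"
    unfolding insertion_def by (simp only: emb_sum emb_mult emb_prod emb_power emb_of_int)
  finally show ?thesis ..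
qed

lemma spec_map_Const:
  "spec \<alpha> (Poly_Mapping.map (\<lambda>c. Fract (Const c) 1) b) = emb (Const (peval (\<chi> j. of_int (\<alpha> j)) b))"
proof -
  have "spec \<alpha> (Poly_Mapping.map (\<lambda>c. Fract (Const c) 1) b)
      = insertion (\<lambda>c. emb (Const c)) (\<lambda>j. of_int (\<alpha> j)) b"
    unfolding spec_def by (rule insertion_map) (simp_all only: emb_zero Const_zero)
  then show ?thesis
    unfolding peval_def insertion_def
    by (simp only: emb_sum Const_sum Const_mult Const_prod emb_mult Const_power emb_prod emb_power vec_lambda_beta
        Const_of_int emb_of_int)
qed

locale weyl_submodule =
  fixes U :: "'n::{finite,linorder} cpoly fract set"
  assumes zero: "0 \<in> U"
    and add: "u \<in> U \<Longrightarrow> v \<in> U \<Longrightarrow> u + v \<in> U"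
    and mult: "u \<in> U \<Longrightarrow> emb p * u \<in> U"
    and deriv: "u \<in> U \<Longrightarrow> pd_fract i u \<in> U"
begin

lemma sum: "(\<And>x. x \<in> A \<Longrightarrow> f x \<in> U) \<Longrightarrow> sum f A \<in> U"
  by (induction A rule: infinite_finite_induct) (auto intro: zero add)

lemma diffop_act_spec:
  assumes nz: "\<And>j. fs j \<noteq> 0" and u: "spec \<alpha> u * fpow fs \<alpha> \<in> U"
  shows "spec \<alpha> (diffop_act fs P u) * fpow fs \<alpha> \<in> U"
proof -
  have step: "spec \<alpha> (pd_fs fs i w) * fpow fs \<alpha> \<in> U" if "spec \<alpha> w * fpow fs \<alpha> \<in> U" for i w
    unfolding spec_pd_fs[where fs = fs, OF nz] using that by (rule deriv)
  have steps: "spec \<alpha> ((pd_fs fs i ^^ n) w) * fpow fs \<alpha> \<in> U" if "spec \<alpha> w * fpow fs \<alpha> \<in> U" for i w n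
    using that by (induction n) (auto intro: step)
  have "spec \<alpha> (fold (\<lambda>i. pd_fs fs i ^^ Poly_Mapping.lookup \<beta> i) xs w) * fpow fs \<alpha> \<in> U"
    if "spec \<alpha> w * fpow fs \<alpha> \<in> U" for \<beta> xs w
    using that by (induction xs arbitrary: w) (auto intro: steps)
  then have pow: "spec \<alpha> (pd_fs_pow fs \<beta> u) * fpow fs \<alpha> \<in> U" for \<beta>
    unfolding pd_fs_pow_def using u by blast
  have "spec \<alpha> (Poly_Mapping.map (\<lambda>p. Fract p 1) w * pd_fs_pow fs \<beta> u) * fpow fs \<alpha> \<in> U" for w \<beta>
  proof -
    obtain q where "spec \<alpha> (Poly_Mapping.map (\<lambda>p. Fract p 1) w) = emb q"
      using spec_map_emb by blast
    then show ?thesis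
      using mult[OF pow, of q \<beta>] by (simp only: spec.insertion_mult mult.assoc)
  qed
  then show ?thesis
    unfolding diffop_act_def spec.insertion_sum sum_distrib_right by (intro sum)
qed

text \<open>All that is kept of the operator \<open>P\<close> is that submodules are stable under
  it, so a submodule containing f^(\<alpha>+1) contains b(\<alpha>) f^\<alpha>.\<close>

lemma bernstein_sato_spec:
  assumes nz: "\<And>j. fs j \<noteq> 0" and U: "fpow fs (\<lambda>j. \<alpha> j + 1) \<in> U"
    and b: "b \<in> bernstein_sato_ideal fs"
  shows "emb (Const (peval (\<chi> j. of_int (\<alpha> j)) b)) * fpow fs \<alpha> \<in> U"
proof -
  obtain P where P: "Poly_Mapping.map (\<lambda>c. Fract (Const c) 1) b
      = diffop_act fs P (Const (Fract (\<Prod>j\<in>UNIV. fs j) 1))"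
    using b by (auto simp: bernstein_sato_ideal_def)
  have "spec \<alpha> (Const (emb (\<Prod>j\<in>UNIV. fs j))) * fpow fs \<alpha> = fpow fs (\<lambda>j. \<alpha> j + 1)"
    using nz by (simp only: spec.insertion_Const emb_prod fpow_def prod.distrib[symmetric]
        power_int_add_1' emb_eq_zero_iff not_False_eq_True simp_thms)
  with U have "spec \<alpha> (Const (emb (\<Prod>j\<in>UNIV. fs j))) * fpow fs \<alpha> \<in> U"
    by simp
  from diffop_act_spec[OF nz this, of P] show ?thesis
    by (simp only: spec_map_Const flip: P)
qed

end

section \<open>Local cohomology at the intersection of the basis hyperplanes\<close>

definition local_ring :: "'n::{finite,linorder} cpoly \<Rightarrow> 'n cpoly fract set"
  where "local_ring g = {u. \<exists>N q. u * emb g ^ N = emb q}"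

lemma local_ring_mono_exponent:
  assumes "u * emb g ^ N = emb q" "N \<le> M"
  shows "u * emb g ^ M = emb (q * g ^ (M - N))"
proof -
  have "u * emb g ^ M = (u * emb g ^ N) * emb g ^ (M - N)"
    using assms(2) by (simp only: mult.assoc power_add[symmetric] le_add_diff_inverse)
  then show ?thesis
    by (simp only: assms(1) emb_mult emb_power)
qed

lemma weyl_submodule_local_ring:
  assumes g: "g \<noteq> 0"
  shows "weyl_submodule (local_ring g)"
proof
  show "0 \<in> local_ring g"
    unfolding local_ring_def by (auto intro!: exI[of _ 0] simp: emb_zero)
next
  fix u v assume "u \<in> local_ring g" "v \<in> local_ring g"
  then obtain N q N' q' where u: "u * emb g ^ N = emb q" and v: "v * emb g ^ N' = emb q'"
    by (auto simp: local_ring_def)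
  have "(u + v) * emb g ^ max N N'
      = emb (q * g ^ (max N N' - N)) + emb (q' * g ^ (max N N' - N'))"
    by (simp only: distrib_right local_ring_mono_exponent[OF u] local_ring_mono_exponent[OF v]
        max.cobounded1 max.cobounded2)
  then show "u + v \<in> local_ring g"
    unfolding local_ring_def by (metis (mono_tags) emb_add mem_Collect_eq)
next
  fix u p assume "u \<in> local_ring g"
  then obtain N q where "u * emb g ^ N = emb q"
    by (auto simp: local_ring_def)
  then have "emb p * u * emb g ^ N = emb (p * q)"
    by (simp only: mult.assoc emb_mult)
  then show "emb p * u \<in> local_ring g"
    unfolding local_ring_def by blast
next
  fix u i assume "u \<in> local_ring g"
  then obtain N q where u: "u * emb g ^ N = emb q"
    by (auto simp: local_ring_def)
  have g': "emb g \<noteq> 0" using g by (simp only: emb_eq_zero_iff not_False_eq_True)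
  have "pd_fract i u * emb g ^ N + u * (of_nat N * (emb (pd i g) / emb g) * emb g ^ N) = emb (pd i q)"
    using arg_cong[OF u, of "pd_fract i"] g'
    by (simp only: pd_fract_mult pd_fract_power pd_fract_emb not_False_eq_True)
  \<comment> \<open>The extra factor g clears the denominator of the logarithmic derivative of g;
    hence the exponent \<open>Suc N\<close> below.\<close>
  then have "(pd_fract i u * emb g ^ N + of_nat N * (emb (pd i g) / emb g) * (u * emb g ^ N)) * emb g
      = emb (pd i q) * emb g"
    by (simp only: mult_ac)
  moreover have "of_nat N * (emb (pd i g) / emb g) * emb q * emb g = of_nat N * emb (pd i g) * emb q"
    using g' by (simp del: mult_fract divide_fract)
  ultimately have "pd_fract i u * emb g ^ Suc N = emb (pd i q) * emb g - of_nat N * emb (pd i g) * emb q"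
    unfolding u by (simp only: distrib_right power_Suc2 mult.assoc[of "pd_fract i u"] eq_diff_eq)
  also have "\<dots> = emb (pd i q * g - of_nat N * pd i g * q)"
    by (simp only: emb_mult diff_conv_add_uminus emb_add emb_uminus emb_of_nat)
  finally show "pd_fract i u \<in> local_ring g"
    unfolding local_ring_def by blast
qed

text \<open>This is the image of the last differential of the Cech complex of the
  \<open>l v\<close>; the quotient of C[x, 1/\<Prod> l_v] by it is the top local cohomology.\<close>

definition nonpolar :: "('i \<Rightarrow> 'n::{finite,linorder} cpoly) \<Rightarrow> 'i set \<Rightarrow> 'n cpoly fract set"
  where "nonpolar l S = {\<Sum>v\<in>S. u v | u. \<forall>v\<in>S. u v \<in> local_ring (\<Prod>w\<in>S - {v}. l w)}"

lemma weyl_submodule_nonpolar: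
  assumes nz: "\<And>v. v \<in> S \<Longrightarrow> l v \<noteq> 0" and fin: "finite S"
  shows "weyl_submodule (nonpolar l S)"
proof -
  have loc: "weyl_submodule (local_ring (\<Prod>w\<in>S - {v}. l w))" for v
    by (rule weyl_submodule_local_ring) (use nz fin in auto)
  show ?thesis
  proof
    show "0 \<in> nonpolar l S"
      unfolding nonpolar_def
      by (auto intro!: exI[of _ "\<lambda>_. 0"] weyl_submodule.zero[OF loc])
  next
    fix u v assume "u \<in> nonpolar l S" "v \<in> nonpolar l S"
    then obtain u' v' where
      "u = sum u' S" "\<And>w. w \<in> S \<Longrightarrow> u' w \<in> local_ring (\<Prod>x\<in>S - {w}. l x)"
      "v = sum v' S" "\<And>w. w \<in> S \<Longrightarrow> v' w \<in> local_ring (\<Prod>x\<in>S - {w}. l x)"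
      unfolding nonpolar_def by blast
    then show "u + v \<in> nonpolar l S"
      unfolding nonpolar_def
      by (auto simp: sum.distrib intro!: exI[of _ "\<lambda>w. u' w + v' w"] weyl_submodule.add[OF loc])
  next
    fix u p assume "u \<in> nonpolar l S"
    then obtain u' where
      "u = sum u' S" "\<And>w. w \<in> S \<Longrightarrow> u' w \<in> local_ring (\<Prod>x\<in>S - {w}. l x)"
      unfolding nonpolar_def by blast
    then show "emb p * u \<in> nonpolar l S"
      unfolding nonpolar_def
      by (auto simp: sum_distrib_left intro!: exI[of _ "\<lambda>w. emb p * u' w"] weyl_submodule.mult[OF loc])
  next
    fix u i assume "u \<in> nonpolar l S"
    then obtain u' where
      "u = sum u' S" "\<And>w. w \<in> S \<Longrightarrow> u' w \<in> local_ring (\<Prod>x\<in>S - {w}. l x)"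
      unfolding nonpolar_def by blast
    then show "pd_fract i u \<in> nonpolar l S"
      unfolding nonpolar_def
      by (auto simp: pd_fract_sum intro!: exI[of _ "\<lambda>w. pd_fract i (u' w)"] weyl_submodule.deriv[OF loc])
  qed
qed

lemma nonpolar_fraction:
  assumes nz: "\<And>w. w \<in> S \<Longrightarrow> l w \<noteq> 0" and fin: "finite S" and v: "v \<in> S" "e v = 0"
  shows "emb q / (\<Prod>w\<in>S. emb (l w) ^ e w) \<in> nonpolar l S"
proof -
  define u where "u = emb q / (\<Prod>w\<in>S. emb (l w) ^ e w)"
  \<comment> \<open>\<open>local_ring\<close> admits only powers of the whole product, so a common
    bound of the \<open>e w\<close> is taken and the numerator is padded with the missing
    factors.\<close>
  define N where "N = (\<Sum>w\<in>S. e w)"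
  have le: "e w \<le> N" if "w \<in> S" for w
    unfolding N_def using that fin by (intro member_le_sum) auto
  have eq: "(\<Prod>w\<in>S. emb (l w) ^ e w) = (\<Prod>w\<in>S - {v}. emb (l w) ^ e w)"
    using v fin by (subst prod.remove[of S v]) simp_all
  have ne: "(\<Prod>w\<in>S - {v}. emb (l w) ^ e w) \<noteq> 0"
    using nz fin by (auto simp: emb_eq_zero_iff)
  have "emb (\<Prod>w\<in>S - {v}. l w) ^ N
      = (\<Prod>w\<in>S - {v}. emb (l w) ^ e w) * emb (\<Prod>w\<in>S - {v}. l w ^ (N - e w))"
    unfolding emb_prod prod_power_distrib emb_power prod.distrib[symmetric] power_add[symmetric]
    by (intro prod.cong) (use le in auto)
  then have "u * emb (\<Prod>w\<in>S - {v}. l w) ^ N = emb (q * (\<Prod>w\<in>S - {v}. l w ^ (N - e w)))"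
    unfolding u_def eq using ne by (simp add: emb_mult del: mult_fract)
  then have loc: "u \<in> local_ring (\<Prod>w\<in>S - {v}. l w)"
    unfolding local_ring_def by blast
  have "(\<Sum>w\<in>S. if w = v then u else 0) \<in> nonpolar l S"
    unfolding nonpolar_def
  proof (intro CollectI exI conjI ballI)
    fix w assume "w \<in> S"
    show "(if w = v then u else 0) \<in> local_ring (\<Prod>x\<in>S - {w}. l x)"
      using loc by (auto simp: local_ring_def intro!: exI[of _ 0] simp: emb_zero)
  qed simp
  then show ?thesis
    using v fin by (simp add: u_def)
qed

text \<open>\<open>order_ge l S T q\<close> holds when \<open>q\<close> vanishes to order \<open>T\<close> along \<open>l = 0\<close>: then every
  monomial in the expansion of the quotient below has some nonnegative exponent.\<close>
definition order_ge :: "('i \<Rightarrow> 'n::{finite,linorder} cpoly) \<Rightarrow> 'i set \<Rightarrow> nat \<Rightarrow> 'n cpoly \<Rightarrow> bool"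
  where "order_ge l S T q \<longleftrightarrow> (\<forall>e. (\<Sum>v\<in>S. e v) < T + card S \<longrightarrow>
    emb q / (\<Prod>w\<in>S. emb (l w) ^ e w) \<in> nonpolar l S)"

text \<open>Pigeonhole: exponents whose sum is below the number of basis forms leave one of these
  forms out of the denominator.\<close>

lemma order_ge_zero:
  assumes nz: "\<And>w. w \<in> S \<Longrightarrow> l w \<noteq> 0" and fin: "finite S"
  shows "order_ge l S 0 q"
  unfolding order_ge_def
proof (intro allI impI)
  fix e :: "'a \<Rightarrow> nat" assume lt: "(\<Sum>v\<in>S. e v) < 0 + card S"
  have "\<exists>v\<in>S. e v = 0"
  proof (rule ccontr)
    assume "\<not> (\<exists>v\<in>S. e v = 0)"
    then have "(\<Sum>v\<in>S. 1) \<le> (\<Sum>v\<in>S. e v)"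
      by (intro sum_mono) (simp add: Suc_leI)
    with lt show False by simp
  qed
  then show "emb q / (\<Prod>w\<in>S. emb (l w) ^ e w) \<in> nonpolar l S"
    using nonpolar_fraction[where l = l and S = S, OF nz fin] by blast
qed

text \<open>In each term the factor \<open>l v\<close> either cancels against the denominator and
  lowers the sum of the exponents by one, or \<open>l v\<close> is absent from the denominator and
  the term is nonpolar already.\<close>

lemma order_ge_Suc:
  assumes nz: "\<And>w. w \<in> S \<Longrightarrow> l w \<noteq> 0" and fin: "finite S" and q: "order_ge l S T q"
  shows "order_ge l S (Suc T) ((\<Sum>v\<in>S. Const (a v) * l v) * q)"
  unfolding order_ge_def
proof (intro allI impI)
  fix e :: "'a \<Rightarrow> nat" assume lt: "(\<Sum>v\<in>S. e v) < Suc T + card S"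
  have eq: "emb ((\<Sum>v\<in>S. Const (a v) * l v) * q) / (\<Prod>w\<in>S. emb (l w) ^ e w)
      = (\<Sum>v\<in>S. emb (Const (a v)) * (emb (l v * q) / (\<Prod>w\<in>S. emb (l w) ^ e w)))"
    by (simp only: emb_mult emb_sum sum_distrib_right sum_divide_distrib) (simp only: mult_ac times_divide_eq_right)
  have "emb (l v * q) / (\<Prod>w\<in>S. emb (l w) ^ e w) \<in> nonpolar l S" if v: "v \<in> S" for v
  proof (cases "e v = 0")
    case True
    then show ?thesis using nonpolar_fraction[where l = l and S = S, OF nz fin v] by blast
  next
    case False
    let ?e = "e(v := e v - 1)"
    have "(\<Sum>w\<in>S. e w) = e v + (\<Sum>w\<in>S - {v}. e w)" "(\<Sum>w\<in>S. ?e w) = (e v - 1) + (\<Sum>w\<in>S - {v}. e w)"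
      using v fin by (simp_all add: sum.remove)
    then have "(\<Sum>w\<in>S. ?e w) < T + card S"
      using lt False by linarith
    then have "emb q / (\<Prod>w\<in>S. emb (l w) ^ ?e w) \<in> nonpolar l S"
      using q unfolding order_ge_def by blast
    moreover have "(\<Prod>w\<in>S. emb (l w) ^ e w) = emb (l v) * (\<Prod>w\<in>S. emb (l w) ^ ?e w)"
    proof -
      have "(\<Prod>w\<in>S. emb (l w) ^ e w) = emb (l v) ^ e v * (\<Prod>w\<in>S - {v}. emb (l w) ^ e w)"
        "(\<Prod>w\<in>S. emb (l w) ^ ?e w) = emb (l v) ^ (e v - 1) * (\<Prod>w\<in>S - {v}. emb (l w) ^ e w)"
        using v fin by (simp_all add: prod.remove)
      then show ?thesis
        using False by (simp only: mult.assoc[symmetric] power_minus_mult mult.commute[of "emb (l v)"] flip: power_Suc) simp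
    qed
    moreover have "emb (l v) \<noteq> 0" using nz[OF v] by (simp only: emb_eq_zero_iff not_False_eq_True)
    ultimately show ?thesis by (simp add: emb_mult del: mult_fract)
  qed
  then show "emb ((\<Sum>v\<in>S. Const (a v) * l v) * q) / (\<Prod>w\<in>S. emb (l w) ^ e w) \<in> nonpolar l S"
    unfolding eq
    by (intro weyl_submodule.sum weyl_submodule.mult weyl_submodule_nonpolar nz fin)
qed

lemma order_ge_power:
  assumes nz: "\<And>w. w \<in> S \<Longrightarrow> l w \<noteq> 0" and fin: "finite S" and q: "order_ge l S T q"
  shows "order_ge l S (n + T) ((\<Sum>v\<in>S. Const (a v) * l v) ^ n * q)"
proof (induction n)
  case (Suc n)
  from order_ge_Suc[OF nz fin this, where a = a] show ?case
    by (simp add: mult.assoc)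
qed (use q in simp)

text \<open>The arbitrary factor \<open>q\<close> will take up the powers of the forms outside
  J(W).\<close>

lemma order_ge_prod:
  assumes nz: "\<And>w. w \<in> S \<Longrightarrow> l w \<noteq> 0" and fin: "finite S"
    and f: "\<And>j. j \<in> J \<Longrightarrow> f j = (\<Sum>v\<in>S. Const (a j v) * l v)" and finJ: "finite J"
  shows "order_ge l S (\<Sum>j\<in>J. n j) ((\<Prod>j\<in>J. f j ^ n j) * q)"
  using finJ f
proof (induction J)
  case empty
  then show ?case using order_ge_zero[OF nz fin] by simp
next
  case (insert j J)
  from insert have "order_ge l S (\<Sum>j\<in>J. n j) ((\<Prod>j\<in>J. f j ^ n j) * q)" by blast
  from order_ge_power[OF nz fin this, of "n j" "a j"] insert show ?case
    by (simp add: mult.assoc)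
qed

text \<open>After multiplication by a high power of every \<open>l w\<close>, the summand without a
  pole along \<open>l v\<close> keeps the full factor \<open>l v ^ M\<close>. Membership becomes a
  polynomial identity that can be restricted to a slice. Having it for all large M allows M to
  exceed the pole orders of f^\<alpha> as well.\<close>

lemma nonpolarD:
  assumes fin: "finite S" and u: "u \<in> nonpolar l S"
  shows "\<exists>N. \<forall>M\<ge>N. \<exists>q. u * (\<Prod>w\<in>S. emb (l w) ^ M) = emb (\<Sum>v\<in>S. l v ^ M * q v)"
proof -
  obtain u' where u': "u = sum u' S" "\<And>w. w \<in> S \<Longrightarrow> u' w \<in> local_ring (\<Prod>x\<in>S - {w}. l x)"
    using u unfolding nonpolar_def by blast
  then obtain N q where q: "\<And>v. v \<in> S \<Longrightarrow> u' v * emb (\<Prod>x\<in>S - {v}. l x) ^ N v = emb (q v)"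
    unfolding local_ring_def mem_Collect_eq by metis
  show ?thesis
  proof (intro exI[of _ "\<Sum>v\<in>S. N v"] allI impI)
    fix M assume M: "(\<Sum>v\<in>S. N v) \<le> M"
    define q' where "q' v = q v * (\<Prod>x\<in>S - {v}. l x) ^ (M - N v)" for v
    have "u' v * (\<Prod>w\<in>S. emb (l w) ^ M) = emb (l v ^ M * q' v)" if v: "v \<in> S" for v
    proof -
      have "N v \<le> M"
        using M member_le_sum[of v S N] v fin by auto
      then have "u' v * emb (\<Prod>x\<in>S - {v}. l x) ^ M = emb (q' v)"
        unfolding q'_def by (rule local_ring_mono_exponent[OF q[OF v]])
      moreover have "(\<Prod>w\<in>S. emb (l w) ^ M) = emb (\<Prod>x\<in>S - {v}. l x) ^ M * emb (l v) ^ M"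
        using v fin by (simp only: emb_prod prod_power_distrib prod.remove[of S v] mult.commute)
      ultimately show ?thesis
        by (simp only: mult.assoc[symmetric]) (simp only: emb_mult emb_power mult.commute)
    qed
    then have "u * (\<Prod>w\<in>S. emb (l w) ^ M) = (\<Sum>v\<in>S. emb (l v ^ M * q' v))"
      unfolding u'(1) sum_distrib_right by (rule sum.cong[OF refl])
    then show "\<exists>q. u * (\<Prod>w\<in>S. emb (l w) ^ M) = emb (\<Sum>v\<in>S. l v ^ M * q v)"
      by (intro exI[of _ q']) (simp only: emb_sum)
  qed
qed

section \<open>Homogeneous polynomials and restriction to an affine slice\<close>

definition homogeneous_of :: "nat \<Rightarrow> ('v, 'a::zero) mpoly \<Rightarrow> bool"
  where "homogeneous_of d p \<longleftrightarrow> (\<forall>m\<in>Poly_Mapping.keys p. mdegree m = d)"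

lemma homogeneous_of_mult:
  fixes p q :: "('v::finite, 'a::comm_ring_1) mpoly"
  shows "homogeneous_of d p \<Longrightarrow> homogeneous_of d' q \<Longrightarrow> homogeneous_of (d + d') (p * q)"
  unfolding homogeneous_of_def using keys_mult[of p q] by (fastforce simp: mdegree_add)

lemma homogeneous_of_one: "homogeneous_of 0 (1 :: ('v::finite, 'a::comm_ring_1) mpoly)"
  by (simp add: homogeneous_of_def)

lemma homogeneous_of_power:
  fixes p :: "('v::finite, 'a::comm_ring_1) mpoly"
  shows "homogeneous_of d p \<Longrightarrow> homogeneous_of (n * d) (p ^ n)"
  by (induction n) (auto intro: homogeneous_of_mult simp: homogeneous_of_one)

lemma homogeneous_of_prod:
  fixes p :: "'i \<Rightarrow> ('v::finite, 'a::comm_ring_1) mpoly"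
  shows "(\<And>i. i \<in> I \<Longrightarrow> homogeneous_of (d i) (p i)) \<Longrightarrow> finite I \<Longrightarrow>
    homogeneous_of (\<Sum>i\<in>I. d i) (\<Prod>i\<in>I. p i)"
  by (induction I rule: infinite_finite_induct) (auto intro: homogeneous_of_mult simp: homogeneous_of_one)

lemma homogeneous_of_row_form: "homogeneous_of 1 (row_form C S j)"
proof -
  have "Poly_Mapping.lookup (row_form C S j) m = 0" if "mdegree m \<noteq> 1" for m
    using that by (auto simp: row_form_def lookup_sum Var_def Const_mult_single lookup_single when_def
        intro!: sum.neutral)
  then show ?thesis by (force simp: homogeneous_of_def in_keys_iff)
qed

lemma homogeneous_of_form_product:
  fixes S :: "'v::finite set"
  assumes "finite J"
  shows "homogeneous_of (\<Sum>j\<in>J. c j) (form_product C J S c)"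
  unfolding form_product_def
proof (rule homogeneous_of_prod[OF _ assms])
  fix j
  show "homogeneous_of (c j) (row_form C S j ^ c j)"
    using homogeneous_of_power[OF homogeneous_of_row_form, of "c j" C S j] by simp
qed

text \<open>A monomial of the degree of p can only arise with the constant term of q. On the slice,
  p is the product for the non-basis forms of J(W) and q the one for the forms outside J(W).\<close>

lemma lookup_homogeneous_mult:
  fixes p q :: "'v::finite cpoly"
  assumes "homogeneous_of (mdegree e) p"
  shows "Poly_Mapping.lookup (p * q) e = Poly_Mapping.lookup p e * Poly_Mapping.lookup q 0"
proof (induction q rule: mpoly_induct)
  case (step q m c)
  have "Poly_Mapping.lookup (p * Poly_Mapping.single m c) e
      = Poly_Mapping.lookup p e * Poly_Mapping.lookup (Poly_Mapping.single m c) 0"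
  proof (cases "m = 0")
    case True
    then have "p * Poly_Mapping.single m c = Const c * p"
      by (simp add: Const_def mult.commute)
    then show ?thesis using True by (simp add: lookup_Const_mult)
  next
    case False
    have "Poly_Mapping.lookup (p * Poly_Mapping.single m c) e = 0"
    proof (rule ccontr)
      assume "Poly_Mapping.lookup (p * Poly_Mapping.single m c) e \<noteq> 0"
      then have "e \<in> Poly_Mapping.keys (p * Poly_Mapping.single m c)"
        by (simp add: in_keys_iff)
      then obtain n where "n \<in> Poly_Mapping.keys p" "e = n + m"
        using keys_mult[of p "Poly_Mapping.single m c"] by (auto split: if_splits)
      then have "mdegree m = 0"
        using assms by (auto simp: homogeneous_of_def mdegree_add)
      with False show False by simp
    qed
    then show ?thesis using False by (simp add: lookup_single when_def)
  qed
  then show ?case using step by (simp add: distrib_left lookup_add)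
qed simp

lemma peval_zero_eq_lookup: "peval 0 p = Poly_Mapping.lookup p 0"
proof -
  have "(\<Prod>v\<in>UNIV. (0::complex) ^ Poly_Mapping.lookup m v) = (if m = 0 then 1 else 0)"
    for m :: "'a \<Rightarrow>\<^sub>0 nat"
  proof (cases "m = 0")
    case False
    then obtain v where "Poly_Mapping.lookup m v \<noteq> 0"
      by (metis lookup_zero poly_mapping_eqI)
    then show ?thesis using False by (auto intro!: prod_zero bexI[of _ v])
  qed simp
  then have "peval 0 p = (\<Sum>m\<in>Poly_Mapping.keys p. if m = 0 then Poly_Mapping.lookup p 0 else 0)"
    unfolding peval_def zero_index by (intro sum.cong) auto
  then show ?thesis
    by (simp add: in_keys_iff)
qed

lemma linform_eq_zero_iff [simp]: "linform a = 0 \<longleftrightarrow> a = 0"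
proof
  assume "linform a = 0"
  then have "a $ v = 0" for v
    using lookup_linform_single[of a v] by simp
  then show "a = 0" by (simp add: vec_eq_iff)
qed simp

text \<open>The substitution restricts a form to the affine slice y + \<Sum> t_v d_v, with the
  parameters t_v again named \<open>Var v\<close>.\<close>

lemma insertion_affine_linform:
  "insertion Const (\<lambda>w. Const (y $ w) + (\<Sum>v\<in>S. Const (d v $ w) * Var v)) (linform a)
    = Const (pairing a y) + (\<Sum>v\<in>S. Const (pairing a (d v)) * Var v)"
  unfolding linform_def pairing_def
  by (simp add: Const.insertion_simps Const_sum Const_mult distrib_left sum.distrib sum_distrib_left
      sum_distrib_right mult_ac) (rule sum.swap)

lemma lookup_zero_power: "Poly_Mapping.lookup (p ^ n) 0 = Poly_Mapping.lookup p 0 ^ n"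
  for p :: "'v::finite cpoly"
  by (simp add: peval.insertion_power flip: peval_zero_eq_lookup)

lemma lookup_zero_prod: "Poly_Mapping.lookup (prod p I) 0 = (\<Prod>i\<in>I. Poly_Mapping.lookup (p i) 0)"
  for p :: "'i \<Rightarrow> 'v::finite cpoly"
  by (simp add: peval.insertion_prod flip: peval_zero_eq_lookup)

text \<open>The conditions on \<alpha>, c and e make the exponents over \<open>J\<close> add up to -
  card S - k. After multiplication by l_r^k, the fraction b(\<alpha>) f^\<alpha> has pole orders 1 +
  e_v and a numerator of order \<Sum> c_j = \<Sum> e_v along W. On the slice, the coefficient of
  \<Prod> l_v^(-1) is b(\<alpha>) times that of the monomial e in the form product times powers of
  the nonzero values at y of the forms outside \<open>J\<close>. Elements of U have no such
  term.\<close>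

lemma bernstein_sato_vanishes_at_coefficient:
  fixes fs :: "'r::finite \<Rightarrow> 'n::{finite,linorder} cpoly" and \<tau> :: "'n \<Rightarrow> 'r" and d :: "'n \<Rightarrow> complex ^ ('n::{finite,linorder})"
  assumes fs: "\<And>j. fs j = linform (a j)" "\<And>j. a j \<noteq> 0"
    and \<tau>: "inj_on \<tau> S" "\<tau> ` S \<subseteq> J"
    and C: "\<And>j. j \<in> J \<Longrightarrow> a j = (\<Sum>v\<in>S. C j v *s a (\<tau> v))"
    and d: "\<And>v w. v \<in> S \<Longrightarrow> w \<in> S \<Longrightarrow> pairing (a (\<tau> v)) (d w) = (if v = w then 1 else 0)"
    and y: "\<And>j. j \<in> J \<Longrightarrow> pairing (a j) y = 0" "\<And>j. j \<notin> J \<Longrightarrow> pairing (a j) y \<noteq> 0"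
    and r: "r \<in> S" and k: "k < card J"
    and b: "b \<in> bernstein_sato_ideal fs"
    and e: "Poly_Mapping.keys e \<subseteq> S"
    and sum: "(\<Sum>j\<in>J - \<tau> ` S. c j) = (\<Sum>v\<in>S. Poly_Mapping.lookup e v)"
    and nz: "Poly_Mapping.lookup (form_product C (J - \<tau> ` S) S c) e \<noteq> 0"
    and \<alpha>\<tau>: "\<And>v. v \<in> S \<Longrightarrow> \<alpha> (\<tau> v) = - 1 - int (Poly_Mapping.lookup e v + (if v = r then k else 0))"
    and \<alpha>c: "\<And>j. j \<notin> \<tau> ` S \<Longrightarrow> \<alpha> j = int (c j)"
  shows "peval (\<chi> j. of_int (\<alpha> j)) b = 0"
proof -
  define l where "l v = fs (\<tau> v)" for v
  \<comment> \<open>\<open>E v\<close> is the exponent of \<open>l v\<close> in the denominator of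
    f^(\<alpha>+1); for f^\<alpha> it is \<open>Suc (E v)\<close>.\<close>
  define E where "E v = Poly_Mapping.lookup e v + (if v = r then k else 0)" for v
  define U where "U = nonpolar l S"
  have lnz: "l v \<noteq> 0" for v using fs by (simp add: l_def)
  have embl: "emb (l v) \<noteq> 0" for v using lnz by (simp only: emb_eq_zero_iff not_False_eq_True)
  interpret U: weyl_submodule U
    unfolding U_def by (rule weyl_submodule_nonpolar) (simp_all add: lnz)
  have f_in: "fs j = (\<Sum>v\<in>S. Const (C j v) * l v)" if "j \<in> J" for j
  proof -
    have "linform (a j) = linform (\<Sum>v\<in>S. C j v *s a (\<tau> v))"
      using C[OF that] by simp
    then show ?thesis by (simp add: fs l_def linform_sum linform_scale)
  qed
  have split: "(\<Prod>j\<in>UNIV. g j) = (\<Prod>v\<in>S. g (\<tau> v)) * (\<Prod>j\<in>- \<tau> ` S. g j)" for g :: "'r \<Rightarrow> 'n cpoly fract"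
    using prod.union_disjoint[of "\<tau> ` S" "- \<tau> ` S" g] \<tau>(1) by (simp add: prod.reindex Compl_partition)
  have fpow0: "fpow fs \<alpha> = emb (\<Prod>j\<in>- \<tau> ` S. fs j ^ c j) / (\<Prod>v\<in>S. emb (l v) ^ Suc (E v))"
  proof -
    have "(\<Prod>v\<in>S. emb (fs (\<tau> v)) powi \<alpha> (\<tau> v)) = (\<Prod>v\<in>S. inverse (emb (l v) ^ Suc (E v)))"
    proof (rule prod.cong[OF refl])
      fix v assume "v \<in> S"
      then have "\<alpha> (\<tau> v) = - int (Suc (E v))" by (simp add: \<alpha>\<tau> E_def)
      then show "emb (fs (\<tau> v)) powi \<alpha> (\<tau> v) = inverse (emb (l v) ^ Suc (E v))"
        by (simp only: l_def power_int_minus power_int_of_nat)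
    qed
    moreover have "(\<Prod>j\<in>- \<tau> ` S. emb (fs j) powi \<alpha> j) = emb (\<Prod>j\<in>- \<tau> ` S. fs j ^ c j)"
      unfolding emb_prod emb_power by (intro prod.cong) (simp_all add: \<alpha>c)
    ultimately show ?thesis
      unfolding fpow_def split by (simp only: prod_inversef[symmetric] o_def divide_inverse mult.commute)
  qed
  have fpow1: "fpow fs (\<lambda>j. \<alpha> j + 1)
      = emb (\<Prod>j\<in>- \<tau> ` S. fs j ^ Suc (c j)) / (\<Prod>v\<in>S. emb (l v) ^ E v)"
  proof -
    have "(\<Prod>v\<in>S. emb (fs (\<tau> v)) powi (\<alpha> (\<tau> v) + 1)) = (\<Prod>v\<in>S. inverse (emb (l v) ^ E v))"
    proof (rule prod.cong[OF refl])
      fix v assume "v \<in> S"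
      then have "\<alpha> (\<tau> v) + 1 = - int (E v)" by (simp add: \<alpha>\<tau> E_def)
      then show "emb (fs (\<tau> v)) powi (\<alpha> (\<tau> v) + 1) = inverse (emb (l v) ^ E v)"
        by (simp only: l_def power_int_minus power_int_of_nat)
    qed
    moreover have "(\<Prod>j\<in>- \<tau> ` S. emb (fs j) powi (\<alpha> j + 1)) = emb (\<Prod>j\<in>- \<tau> ` S. fs j ^ Suc (c j))"
      unfolding emb_prod emb_power
    proof (rule prod.cong[OF refl])
      fix j assume "j \<in> - \<tau> ` S"
      then have "\<alpha> j + 1 = int (Suc (c j))" by (simp add: \<alpha>c)
      then show "emb (fs j) powi (\<alpha> j + 1) = emb (fs j) ^ Suc (c j)"
        by (simp only: power_int_of_nat)
    qed
    ultimately show ?thesis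
      unfolding fpow_def split by (simp only: prod_inversef[symmetric] o_def divide_inverse mult.commute)
  qed
  have cards: "card (J - \<tau> ` S) + card S = card J"
    using \<tau> by (simp add: card_Diff_subset card_image card_mono)
      (metis card_image card_mono finite le_add_diff_inverse2)
  have sumE: "(\<Sum>v\<in>S. E v) = (\<Sum>v\<in>S. Poly_Mapping.lookup e v) + k"
    using r by (simp add: E_def sum.distrib)
  have "fpow fs (\<lambda>j. \<alpha> j + 1) \<in> U"
  proof -
    have "- \<tau> ` S = (J - \<tau> ` S) \<union> (- J)" using \<tau>(2) by auto
    then have *: "(\<Prod>j\<in>- \<tau> ` S. fs j ^ Suc (c j))
        = (\<Prod>j\<in>J - \<tau> ` S. fs j ^ Suc (c j)) * (\<Prod>j\<in>- J. fs j ^ Suc (c j))"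
      by (simp only: prod.union_disjoint[symmetric] finite disjoint_eq_subset_Compl Diff_subset double_complement)
    have "order_ge l S (\<Sum>j\<in>J - \<tau> ` S. Suc (c j)) (\<Prod>j\<in>- \<tau> ` S. fs j ^ Suc (c j))"
      unfolding * by (rule order_ge_prod[where a = C]) (use lnz f_in in auto)
    \<comment> \<open>The left side is \<Sum> e + k. On the right the added ones and card S make up
      card J, giving \<Sum> c + card J. As the sums of c and e agree, this is k < card J.\<close>
    moreover have "(\<Sum>v\<in>S. E v) < (\<Sum>j\<in>J - \<tau> ` S. Suc (c j)) + card S"
      using k cards sum unfolding sumE sum_Suc by linarith
    ultimately show ?thesis
      unfolding fpow1 U_def order_ge_def by blast
  qed
  then have bU: "emb (Const (peval (\<chi> j. of_int (\<alpha> j)) b)) * fpow fs \<alpha> \<in> U"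
    using fs by (intro U.bernstein_sato_spec b) auto
  define b0 where "b0 = peval (\<chi> j. of_int (\<alpha> j)) b"
  define H where "H = (\<Prod>j\<in>- \<tau> ` S. fs j ^ c j)"
  \<comment> \<open>The factor \<open>l r ^ k\<close> removes the additional k from the pole order
    at r, leaving 1 + e_v for every v.\<close>
  obtain N where N: "\<And>M. M \<ge> N \<Longrightarrow> \<exists>q. emb (l r ^ k) * (emb (Const b0) * fpow fs \<alpha>) * (\<Prod>w\<in>S. emb (l w) ^ M)
      = emb (\<Sum>v\<in>S. l v ^ M * q v)"
    using nonpolarD[OF _ U.mult[OF bU, of "l r ^ k", unfolded U_def]] unfolding b0_def by auto
  \<comment> \<open>M also dominates all pole orders \<open>Suc (E v)\<close>, so the differences of
    natural numbers below are not truncated.\<close>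
  define M where "M = N + (\<Sum>v\<in>S. Suc (E v))"
  have EM: "Suc (E v) \<le> M" if "v \<in> S" for v
    using member_le_sum[of v S "\<lambda>v. Suc (E v)"] that by (simp add: M_def)
  obtain q where q: "emb (l r ^ k) * (emb (Const b0) * fpow fs \<alpha>) * (\<Prod>w\<in>S. emb (l w) ^ M)
      = emb (\<Sum>v\<in>S. l v ^ M * q v)"
    using N[of M] by (auto simp: M_def)
  have "emb (l r ^ k) * (emb (Const b0) * fpow fs \<alpha>) * (\<Prod>w\<in>S. emb (l w) ^ M)
      = emb (Const b0 * H * (\<Prod>w\<in>S. l w ^ (M - Suc (Poly_Mapping.lookup e w))))"
  proof -
    have ne: "(\<Prod>v\<in>S. emb (l v) ^ Suc (E v)) \<noteq> 0"
      using embl by (simp del: power_Suc)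
    have "(\<Prod>w\<in>S. emb (l w) ^ M) = (\<Prod>w\<in>S. emb (l w) ^ Suc (E w)) * (\<Prod>w\<in>S. emb (l w) ^ (M - Suc (E w)))"
      unfolding prod.distrib[symmetric] power_add[symmetric]
      by (intro prod.cong) (simp_all only: le_add_diff_inverse EM)
    then have 1: "fpow fs \<alpha> * (\<Prod>w\<in>S. emb (l w) ^ M) = emb H * (\<Prod>w\<in>S. emb (l w) ^ (M - Suc (E w)))"
      unfolding fpow0 H_def[symmetric] using ne by (simp del: power_Suc mult_fract divide_fract)
    have exponent: "(if w = r then k else 0) + (M - Suc (E w)) = M - Suc (Poly_Mapping.lookup e w)"
      if "w \<in> S" for w
      using EM[OF that] by (auto simp: E_def)
    have "emb (l r ^ k) = (\<Prod>w\<in>S. emb (l w) ^ (if w = r then k else 0))"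
      using r by (simp only: emb_power if_distrib[of "\<lambda>n. _ ^ n"] power_0 prod.delta finite if_True)
    then have "emb (l r ^ k) * (\<Prod>w\<in>S. emb (l w) ^ (M - Suc (E w)))
        = (\<Prod>w\<in>S. emb (l w) ^ ((if w = r then k else 0) + (M - Suc (E w))))"
      by (simp only: prod.distrib power_add)
    then have 2: "emb (l r ^ k) * (\<Prod>w\<in>S. emb (l w) ^ (M - Suc (E w)))
        = (\<Prod>w\<in>S. emb (l w) ^ (M - Suc (Poly_Mapping.lookup e w)))"
      by (simp only: exponent cong: prod.cong)
    have "emb (l r ^ k) * (emb (Const b0) * fpow fs \<alpha>) * (\<Prod>w\<in>S. emb (l w) ^ M)
        = emb (Const b0) * (emb (l r ^ k) * (fpow fs \<alpha> * (\<Prod>w\<in>S. emb (l w) ^ M)))"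
      by (simp only: mult_ac)
    also have "\<dots> = emb (Const b0) * emb H * (emb (l r ^ k) * (\<Prod>w\<in>S. emb (l w) ^ (M - Suc (E w))))"
      unfolding 1 by (simp only: mult_ac)
    finally show ?thesis
      unfolding 2 by (simp only: emb_mult emb_prod emb_power)
  qed
  with q have id0: "Const b0 * H * (\<Prod>w\<in>S. l w ^ (M - Suc (Poly_Mapping.lookup e w))) = (\<Sum>v\<in>S. l v ^ M * q v)"
    by (simp only: emb_eq_iff)
  have id: "Const b0 * \<psi> H * (\<Prod>w\<in>S. \<psi> (l w) ^ (M - Suc (Poly_Mapping.lookup e w)))
      = (\<Sum>v\<in>S. \<psi> (l v) ^ M * \<psi> (q v))"
    if "\<psi> = insertion Const (\<lambda>w. Const (y $ w) + (\<Sum>v\<in>S. Const (d v $ w) * Var v))" for \<psi>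
    using arg_cong[OF id0, of \<psi>] unfolding that by (simp only: Const.insertion_simps)
  \<comment> \<open>The slice passes through y and is transversal to W: basis forms become
    variables, the other forms of \<open>J\<close> become row forms, and a form outside
    \<open>J\<close> has the nonzero constant term \<open>pairing (a j) y\<close>.\<close>
  define \<psi> where "\<psi> = insertion Const (\<lambda>w. Const (y $ w) + (\<Sum>v\<in>S. Const (d v $ w) * Var v))"
  have \<psi>l: "\<psi> (l v) = Var v" if v: "v \<in> S" for v
  proof -
    have "\<psi> (l v) = (\<Sum>w\<in>S. Const (if v = w then 1 else 0) * Var w)"
      unfolding \<psi>_def l_def fs insertion_affine_linform
      using v \<tau>(2) y(1)[of "\<tau> v"] by (auto intro!: sum.cong simp: d)
    also have "\<dots> = (\<Sum>w\<in>S. if v = w then Var w else 0)"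
      by (intro sum.cong) auto
    finally show ?thesis using v by simp
  qed
  have \<psi>J: "\<psi> (fs j) = row_form C S j" if "j \<in> J" for j
    unfolding f_in[OF that] row_form_def \<psi>_def
    by (simp add: Const.insertion_simps \<psi>l[unfolded \<psi>_def] cong: sum.cong)
  have \<psi>c: "Poly_Mapping.lookup (\<psi> (fs j)) 0 = pairing (a j) y" for j
    unfolding \<psi>_def fs insertion_affine_linform
    by (simp add: peval.insertion_simps flip: peval_zero_eq_lookup)
  have \<psi>H: "\<psi> H = form_product C (J - \<tau> ` S) S c * (\<Prod>j\<in>- J. \<psi> (fs j) ^ c j)"
  proof -
    have "- \<tau> ` S = (J - \<tau> ` S) \<union> (- J)" using \<tau>(2) by auto
    then have "\<psi> H = (\<Prod>j\<in>J - \<tau> ` S. \<psi> (fs j) ^ c j) * (\<Prod>j\<in>- J. \<psi> (fs j) ^ c j)"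
      unfolding H_def \<psi>_def Const.insertion_prod Const.insertion_power
      by (simp only: prod.union_disjoint[symmetric] finite disjoint_eq_subset_Compl Diff_subset double_complement)
    moreover have "(\<Prod>j\<in>J - \<tau> ` S. \<psi> (fs j) ^ c j) = form_product C (J - \<tau> ` S) S c"
      unfolding form_product_def by (intro prod.cong) (simp_all add: \<psi>J)
    ultimately show ?thesis by simp
  qed
  define \<nu> where "\<nu> = (\<Sum>w\<in>S. Poly_Mapping.single w (M - Suc (Poly_Mapping.lookup e w)))"
  have prodVar: "(\<Prod>w\<in>T. Var w ^ n w) = Poly_Mapping.single (\<Sum>w\<in>T. Poly_Mapping.single w (n w)) (1::complex)" 
    if "finite T" for T :: "'n set" and n
    using that by induction (simp_all add: Var_power mult_single)
  have \<nu>: "(\<Prod>w\<in>S. \<psi> (l w) ^ (M - Suc (Poly_Mapping.lookup e w))) = Poly_Mapping.single \<nu> 1"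
    unfolding \<nu>_def prodVar[OF finite, symmetric] by (intro prod.cong) (simp_all add: \<psi>l)
  \<comment> \<open>The exponent M - 1 is one less than the power of \<open>Var v\<close> dividing
    the v-th term on the right, so the monomial \<nu> + e occurs in none of these terms.\<close>
  have look: "Poly_Mapping.lookup (\<nu> + e) v = M - 1" if v: "v \<in> S" for v
  proof -
    have "Poly_Mapping.lookup \<nu> v = (\<Sum>w\<in>S. if w = v then M - Suc (Poly_Mapping.lookup e w) else 0)"
      unfolding \<nu>_def lookup_sum by (intro sum.cong) (auto simp: lookup_single when_def)
    then show ?thesis
      using v EM[OF v] by (simp add: lookup_add E_def split: if_splits)
  qed
  have "Poly_Mapping.lookup (\<Sum>v\<in>S. \<psi> (l v) ^ M * \<psi> (q v)) (\<nu> + e) = 0"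
    unfolding lookup_sum
  proof (rule sum.neutral, rule ballI)
    fix v assume v: "v \<in> S"
    show "Poly_Mapping.lookup (\<psi> (l v) ^ M * \<psi> (q v)) (\<nu> + e) = 0"
      unfolding \<psi>l[OF v] Var_power
      by (rule lookup_single_mult_nle[where v = v]) (use look[OF v] EM[OF v] in simp)
  qed
  moreover have "Poly_Mapping.lookup (Const b0 * \<psi> H * (\<Prod>w\<in>S. \<psi> (l w) ^ (M - Suc (Poly_Mapping.lookup e w)))) (\<nu> + e)
      = b0 * Poly_Mapping.lookup (\<psi> H) e"
    unfolding \<nu> by (simp only: mult.commute[of _ "Poly_Mapping.single \<nu> 1"] lookup_single_mult_add lookup_Const_mult)
  ultimately have "b0 * Poly_Mapping.lookup (\<psi> H) e = 0"
    unfolding id[OF \<psi>_def] by simp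
  moreover have "Poly_Mapping.lookup (\<psi> H) e \<noteq> 0"
  proof -
    have "mdegree e = (\<Sum>j\<in>J - \<tau> ` S. c j)"
      unfolding sum mdegree_def by (rule sum.mono_neutral_left) (use e in \<open>auto simp: in_keys_iff\<close>)
    then have "homogeneous_of (mdegree e) (form_product C (J - \<tau> ` S) S c)"
      by (simp add: homogeneous_of_form_product)
    then show ?thesis
      unfolding \<psi>H using nz y(2) by (simp add: lookup_homogeneous_mult lookup_zero_prod lookup_zero_power \<psi>c)
  qed
  ultimately show ?thesis by (simp add: b0_def)
qed

section \<open>Hyperplanes and linear algebra\<close>

lemma finite_affine_zeros:
  fixes a b :: complex
  assumes "a \<noteq> 0 \<or> a + b \<noteq> 0"
  shows "finite {t. a + t * b = 0}"
proof (cases "b = 0")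
  case False
  then have "{t. a + t * b = 0} \<subseteq> {- a / b}"
    by (auto simp: field_simps eq_neg_iff_add_eq_0)
  then show ?thesis by (rule finite_subset) simp
qed (use assms in auto)

definition line_closed :: "(complex ^ 'n) set \<Rightarrow> bool"
  where "line_closed V \<longleftrightarrow> (\<forall>p\<in>V. \<forall>q\<in>V. \<forall>t. p + t *s (q - p) \<in> V)"

text \<open>A point that is good for the earlier functions is joined with one that is good for the
  new function. On this line none of the functions vanishes identically, so each excludes finitely
  many t. The constants \<open>c j\<close> allow for constant terms in the polynomials defining an
  arrangement.\<close>

lemma avoid_affine_zeros:
  fixes V :: "(complex ^ 'n::finite) set"
  assumes fin: "finite J" and V: "line_closed V" "V \<noteq> {}"
    and ne: "\<And>j. j \<in> J \<Longrightarrow> \<exists>x\<in>V. c j + pairing (a j) x \<noteq> 0"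
  shows "\<exists>x\<in>V. \<forall>j\<in>J. c j + pairing (a j) x \<noteq> 0"
  using fin ne
proof (induction J)
  case empty
  then show ?case using V by auto
next
  case (insert i J)
  then obtain p where p: "p \<in> V" "\<And>j. j \<in> J \<Longrightarrow> c j + pairing (a j) p \<noteq> 0" by blast
  obtain q where q: "q \<in> V" "c i + pairing (a i) q \<noteq> 0"
    using insert.prems by blast
  define A where "A j = c j + pairing (a j) p" for j
  define B where "B j = pairing (a j) (q - p)" for j
  have "finite {t. A j + t * B j = 0}" if "j \<in> insert i J" for j
  proof (rule finite_affine_zeros)
    show "A j \<noteq> 0 \<or> A j + B j \<noteq> 0"
      using that p q by (auto simp: A_def B_def pairing_diff_right)
  qed
  then have "finite (\<Union>j\<in>insert i J. {t. A j + t * B j = 0})"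
    using insert.hyps by blast
  then obtain t where t: "t \<notin> (\<Union>j\<in>insert i J. {t. A j + t * B j = 0})"
    using ex_new_if_finite[OF infinite_UNIV_char_0] by blast
  have "c j + pairing (a j) (p + t *s (q - p)) \<noteq> 0" if "j \<in> insert i J" for j
    unfolding pairing_add_right pairing_scale_right
    using t that by (auto simp: A_def B_def add.assoc)
  moreover have "p + t *s (q - p) \<in> V"
    using V p q by (simp add: line_closed_def)
  ultimately show ?case by blast
qed

lemma line_closed_hyperplane: "line_closed {x. c + pairing a x = 0}"
proof -
  have "c + pairing a (p + t *s (q - p)) = (1 - t) * (c + pairing a p) + t * (c + pairing a q)" for p q t
    by (simp add: pairing_add_right pairing_scale_right pairing_diff_right algebra_simps)
  then show ?thesis by (simp add: line_closed_def)
qed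

lemma zeros_affine: "zeros (Const c + linform a) = {x. c + pairing a x = 0}"
  by (simp add: zeros_def peval.insertion_simps peval_linform)

lemma zeros_linform: "zeros (linform a) = {x. pairing a x = 0}"
  by (simp add: zeros_def peval_linform)

lemma hyperplane_nonempty:
  assumes "a \<noteq> 0"
  shows "\<exists>x. c + pairing a x = 0"
proof -
  obtain v where "a $ v \<noteq> 0"
    using assms by (auto simp: vec_eq_iff)
  then show ?thesis
    by (intro exI[of _ "(- c / a $ v) *s axis v 1"])
      (simp only: pairing_scale_right pairing_axis, simp)
qed

text \<open>Moving inside the hyperplane along a vector z that a' kills, and that is supported on
  two coordinates, compares the corresponding entries of a and a'. An inclusion is enough, and this
  is what covering arguments deliver.\<close>

lemma hyperplane_subset:
  assumes a': "a' \<noteq> 0" and a: "a \<noteq> 0"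
    and sub: "\<And>x. c + pairing a' x = 0 \<Longrightarrow> d + pairing a x = 0"
  shows "\<exists>k. k \<noteq> 0 \<and> a = k *s a' \<and> d = k * c"
proof -
  obtain v where v: "a' $ v \<noteq> 0"
    using a' by (auto simp: vec_eq_iff)
  obtain x0 where x0: "c + pairing a' x0 = 0"
    using hyperplane_nonempty[OF a'] by blast
  define k where "k = a $ v / a' $ v"
  have "a $ w = k * a' $ w" for w
  proof -
    define z where "z = axis w 1 - (a' $ w / a' $ v) *s axis v (1::complex)"
    have "pairing a' z = 0"
      using v by (simp add: z_def pairing_diff_right pairing_scale_right)
    then have "d + pairing a x0 = 0" "d + pairing a (x0 + z) = 0"
      using x0 sub[of x0] sub[of "x0 + z"] by (simp_all add: pairing_add_right)
    then have "pairing a z = 0"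
      by (simp add: pairing_add_right add.assoc[symmetric])
    then show ?thesis
      by (simp add: z_def k_def pairing_diff_right pairing_scale_right)
  qed
  then have ak: "a = k *s a'" by (simp add: vec_eq_iff)
  moreover have "k \<noteq> 0" using a ak by auto
  moreover have "d = k * c"
  proof -
    have "pairing a' x0 = - c" using x0 by (simp add: eq_neg_iff_add_eq_0 add.commute)
    then show ?thesis using sub[OF x0] by (simp add: ak pairing_scale_left)
  qed
  ultimately show ?thesis by blast
qed

lemma linear_poly_same_zeros:
  fixes p :: "'n::finite cpoly"
  assumes p: "linear_poly p" and a: "a \<noteq> 0" and eq: "zeros p = zeros (linform a)"
  shows "\<exists>k. k \<noteq> 0 \<and> p = Const k * linform a"
proof -
  obtain c a' where a': "a' \<noteq> 0" "p = Const c + linform a'"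
    using linear_polyE[OF p] by metis
  have "\<exists>k. k \<noteq> 0 \<and> a' = k *s a \<and> c = k * 0"
    by (rule hyperplane_subset[OF a a'(1)])
      (use eq in \<open>auto simp: a'(2) zeros_affine zeros_linform set_eq_iff\<close>)
  then show ?thesis
    using a'(2) by (auto simp: linform_scale)
qed

text \<open>A basis of the span of the a_j is extended to one of C^n, whose elements are labelled by
  coordinates through \<rho>. They are the rows of \<open>R\<close>, and the columns of the inverse
  \<open>B\<close> are the dual basis. Labels in the type of the coordinates let the given variables
  serve as the new coordinates too. The last clause is the codimension of the common zero
  space.\<close>

lemma linear_forms_basis:
  fixes a :: "'r::finite \<Rightarrow> complex ^ 'n::finite"
  obtains S :: "'n set" and \<tau> :: "'n \<Rightarrow> 'r" and B :: "complex ^ 'n ^ 'n"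
  where "inj_on \<tau> S" "\<tau> ` S \<subseteq> J" "invertible B"
    "\<And>v w. v \<in> S \<Longrightarrow> pairing (a (\<tau> v)) (column w B) = (if v = w then 1 else 0)"
    "\<And>j. j \<in> J \<Longrightarrow> a j = (\<Sum>v\<in>S. pairing (a j) (column v B) *s a (\<tau> v))"
    "card S = CARD('n) - vec.dim {x. \<forall>j\<in>J. pairing (a j) x = 0}"
proof -
  obtain T where T: "T \<subseteq> a ` J" "vec.independent T" "a ` J \<subseteq> vec.span T"
    by (rule vec.maximal_independent_subset)
  obtain T' where T': "T \<subseteq> T'" "vec.independent T'" "UNIV \<subseteq> vec.span T'"
    using vec.maximal_independent_subset_extend[OF subset_UNIV T(2)] by metis
  have finT': "finite T'" by (rule vec.finiteI_independent[OF T'(2)])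
  have "card T' = CARD('n)"
    using vec.basis_card_eq_dim[OF subset_UNIV T'(3,2)] vec_dim_card by metis
  then obtain \<rho> where \<rho>: "bij_betw \<rho> (UNIV :: 'n set) T'"
    using finite_same_card_bij[OF finite finT'] by metis
  have inj: "inj \<rho>" and ran: "range \<rho> = T'"
    using \<rho> by (auto simp: bij_betw_def)
  define S where "S = \<rho> -` T"
  have \<rho>S: "\<rho> ` S = T" using T'(1) ran by (auto simp: S_def)
  \<comment> \<open>Repeated factors give several indices with the same vector; one is chosen for
    each basis element.\<close>
  define \<tau> where "\<tau> v = (SOME j. j \<in> J \<and> a j = \<rho> v)" for v
  have \<tau>: "\<tau> v \<in> J" "a (\<tau> v) = \<rho> v" if "v \<in> S" for v
  proof -
    have "\<rho> v \<in> a ` J" using that T(1) by (auto simp: S_def)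
    then have "\<exists>j. j \<in> J \<and> a j = \<rho> v" by (metis imageE)
    from someI_ex[OF this] have "\<tau> v \<in> J \<and> a (\<tau> v) = \<rho> v" by (simp only: \<tau>_def)
    then show "\<tau> v \<in> J" "a (\<tau> v) = \<rho> v" by simp_all
  qed
  define R where "R = (\<chi> v. \<rho> v)"
  have "\<forall>c. (\<Sum>i\<in>UNIV. c i *s row i R) = 0 \<longrightarrow> (\<forall>i. c i = 0)"
  proof (intro allI impI)
    fix c i assume c: "(\<Sum>i\<in>UNIV. c i *s row i R) = 0"
    have "(\<Sum>t\<in>range \<rho>. c (inv \<rho> t) *s t) = (\<Sum>i\<in>UNIV. c i *s \<rho> i)"
      using inj by (simp add: sum.reindex)
    also have "\<dots> = 0" using c by (simp add: R_def row_def)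
    finally have "c (inv \<rho> (\<rho> i)) = 0"
      using vec.independentD[OF T'(2) finT' subset_refl, of "\<lambda>t. c (inv \<rho> t)" "\<rho> i"] ran by auto
    then show "c i = 0" using inj by simp
  qed
  then obtain B where B: "R ** B = mat 1"
    using matrix_right_invertible_independent_rows[of R] by blast
  have dual: "pairing (\<rho> v) (column w B) = (if v = w then 1 else 0)" for v w
  proof -
    have "pairing (\<rho> v) (column w B) = (R ** B) $ v $ w"
      by (simp add: pairing_def matrix_matrix_mult_def column_def R_def)
    then show ?thesis by (simp add: B mat_def)
  qed
  have invB: "invertible B"
    using B invertible_left_inverse by blast
  have injS: "inj_on \<tau> S"
    by (rule inj_onI) (metis \<tau>(2) inj injD)
  have expand: "a j = (\<Sum>v\<in>S. pairing (a j) (column v B) *s a (\<tau> v))" if j: "j \<in> J" for j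
  proof -
    have "finite T" using T'(1) finT' finite_subset by blast
    then have "a j \<in> range (\<lambda>u. \<Sum>t\<in>T. u t *s t)"
      using T(3) j vec.span_finite by blast
    then obtain u where "a j = (\<Sum>t\<in>T. u t *s t)" by blast
    then have u: "a j = (\<Sum>v\<in>S. u (\<rho> v) *s \<rho> v)"
      using inj by (simp add: \<rho>S[symmetric] sum.reindex inj_on_subset)
    have "pairing (a j) (column w B) = u (\<rho> w)" if "w \<in> S" for w
      unfolding u using that by (simp add: pairing_sum_left pairing_scale_left dual if_distrib cong: if_cong)
    then show ?thesis
      by (subst u) (intro sum.cong; simp add: \<tau>)
  qed
  \<comment> \<open>In the coordinates given by \<open>R\<close>, the common zeros form the
    coordinate subspace whose entries in \<open>S\<close> vanish.\<close>
  have "{x. \<forall>j\<in>J. pairing (a j) x = 0} = (*v) B ` {z. \<forall>i. i \<notin> - S \<longrightarrow> z $ i = 0}"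
  proof (rule set_eqI, rule iffI)
    fix x assume x: "x \<in> {x. \<forall>j\<in>J. pairing (a j) x = 0}"
    have "(R *v x) $ v = 0" if "v \<in> S" for v
    proof -
      have "(R *v x) $ v = pairing (a (\<tau> v)) x"
        using that by (simp add: \<tau> matrix_vector_mult_def pairing_def R_def)
      also have "\<dots> = 0" using x \<tau>(1)[OF that] by blast
      finally show ?thesis .
    qed
    moreover have "x = B *v (R *v x)"
      using B by (simp add: matrix_vector_mul_assoc matrix_left_right_inverse[of R B])
    ultimately show "x \<in> (*v) B ` {z. \<forall>i. i \<notin> - S \<longrightarrow> z $ i = 0}" by auto
  next
    fix x assume "x \<in> (*v) B ` {z. \<forall>i. i \<notin> - S \<longrightarrow> z $ i = 0}"
    then obtain z where z: "x = B *v z" "\<And>i. i \<in> S \<Longrightarrow> z $ i = 0" by auto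
    have "pairing (\<rho> v) x = 0" if "v \<in> S" for v
    proof -
      have "pairing (\<rho> v) x = (R *v x) $ v"
        by (simp add: matrix_vector_mult_def pairing_def R_def)
      also have "R *v x = z"
        using B by (simp add: z(1) matrix_vector_mul_assoc)
      finally show ?thesis using z(2) that by simp
    qed
    then have "pairing (a j) x = 0" if "j \<in> J" for j
      by (subst expand[OF that]) (simp add: pairing_sum_left pairing_scale_left \<tau>)
    then show "x \<in> {x. \<forall>j\<in>J. pairing (a j) x = 0}" by simp
  qed
  moreover have "inj ((*v) B)"
    by (rule injI) (metis B matrix_vector_mul_assoc matrix_vector_mul_lid)
  ultimately have "vec.dim {x. \<forall>j\<in>J. pairing (a j) x = 0} = card (- S)"
    using vec.dim_image_eq[OF matrix_vector_mul_linear_gen[of B], of "{z. \<forall>i. i \<notin> - S \<longrightarrow> z $ i = 0}"]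
      dim_substandard_cart[where d = "- S"]
    by (simp add: inj_on_subset)
  then have "card S = CARD('n) - vec.dim {x. \<forall>j\<in>J. pairing (a j) x = 0}"
    using card_Un_disjoint[of S "- S"] by (simp add: Compl_partition)
  then show thesis
    using that[OF injS _ invB _ expand] \<tau> dual by auto
qed

section \<open>Irreducibility\<close>

lemma vars_mult: "vars (p * q) \<subseteq> vars p \<union> vars q"
  for p q :: "('v, 'a::comm_ring_1) mpoly"
proof
  fix v assume "v \<in> vars (p * q)"
  then obtain m where "m \<in> Poly_Mapping.keys (p * q)" "v \<in> Poly_Mapping.keys m"
    by (auto simp: vars_def)
  then obtain m1 m2 where "m1 \<in> Poly_Mapping.keys p" "m2 \<in> Poly_Mapping.keys q"
    "v \<in> Poly_Mapping.keys (m1 + m2)"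
    using keys_mult[of p q] by blast
  moreover from this have "v \<in> Poly_Mapping.keys m1 \<or> v \<in> Poly_Mapping.keys m2"
    using keys_add[of m1 m2] by blast
  ultimately show "v \<in> vars p \<union> vars q"
    by (auto simp: vars_def)
qed

lemma vars_prod: "(\<And>i. i \<in> I \<Longrightarrow> vars (p i) \<subseteq> V) \<Longrightarrow> vars (\<Prod>i\<in>I. p i) \<subseteq> V"
  for p :: "'i \<Rightarrow> ('v, 'a::comm_ring_1) mpoly"
proof (induction I rule: infinite_finite_induct)
  case (insert i I)
  then show ?case using vars_mult[of "p i" "\<Prod>i\<in>I. p i"] by auto
qed (simp_all add: vars_def)

lemma vars_linform: "vars (linform a) \<subseteq> {v. a $ v \<noteq> 0}"
proof
  fix v assume "v \<in> vars (linform a)"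
  then obtain m where m: "Poly_Mapping.lookup (linform a) m \<noteq> 0" "v \<in> Poly_Mapping.keys m"
    by (auto simp: vars_def in_keys_iff)
  then have "mdegree m = 1" using lookup_linform_other by metis
  then obtain w where "m = Poly_Mapping.single w 1" by (rule mdegree_one_cases)
  with m show "v \<in> {v. a $ v \<noteq> 0}"
    by (auto simp: lookup_linform_single[simplified] split: if_splits)
qed

lemma vars_eq_empty:
  fixes p :: "'v::finite cpoly"
  assumes "vars p = {}" "peval 0 p = 0"
  shows "p = 0"
proof (rule poly_mapping_eqI)
  fix m
  show "Poly_Mapping.lookup p m = Poly_Mapping.lookup 0 m"
  proof (cases "m = 0")
    case True
    then show ?thesis using assms(2) by (simp add: peval_zero_eq_lookup)
  next
    case False
    then have "m \<notin> Poly_Mapping.keys p"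
      using assms(1) by (auto simp: vars_def)
    then show ?thesis by (simp add: in_keys_iff)
  qed
qed

text \<open>If no form met both \<open>T\<close> and \<open>S - T\<close>, the change of coordinates \<open>B\<close> would split the
  defining polynomial of the localization.\<close>
lemma irreducible_connected:
  fixes a :: "'r::finite \<Rightarrow> complex ^ ('n::{finite,linorder})"
    and \<tau> :: "'n \<Rightarrow> 'r" and B :: "(complex ^ ('n::{finite,linorder})) ^ ('n::{finite,linorder})"
    and D' :: "(complex ^ ('n::{finite,linorder})) set set"
  assumes irr: "irreducible_arrangement D'" and fin: "finite D'"
    and D': "D' = (\<lambda>j. zeros (linform (a j))) ` J"
    and a: "\<And>j. j \<in> J \<Longrightarrow> a j \<noteq> 0"
    and \<tau>: "inj_on \<tau> S" "\<tau> ` S \<subseteq> J" and B: "invertible B"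
    and dual: "\<And>v w. v \<in> S \<Longrightarrow> pairing (a (\<tau> v)) (column w B) = (if v = w then 1 else 0)"
    and expand: "\<And>j. j \<in> J \<Longrightarrow> a j = (\<Sum>v\<in>S. pairing (a j) (column v B) *s a (\<tau> v))"
    and T: "T \<noteq> {}" "T \<subset> S"
  shows "\<exists>j\<in>J. (\<exists>v\<in>T. pairing (a j) (column v B) \<noteq> 0) \<and> (\<exists>v\<in>S - T. pairing (a j) (column v B) \<noteq> 0)"
proof (rule ccontr)
  assume contra: "\<not> ?thesis"
  obtain q l where l: "\<And>H. H \<in> D' \<Longrightarrow> linear_poly (l H) \<and> H = zeros (l H)"
    and q: "q = (\<Prod>H\<in>D'. l H)"
    and nosplit: "\<And>A g h. invertible A \<Longrightarrow> lin_change A q = g * h \<Longrightarrow>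
          vars g \<noteq> {} \<Longrightarrow> vars h \<noteq> {} \<Longrightarrow> vars g \<inter> vars h \<noteq> {}"
    using irr unfolding irreducible_arrangement_def defining_polynomial_def by metis
  define c where "c j = (\<chi> w. pairing (a j) (column w B))" for j
  have cS: "c j $ w = 0" if "j \<in> J" "w \<notin> S" for j w
  proof -
    have "pairing (a j) (column w B) = (\<Sum>v\<in>S. pairing (a j) (column v B) * pairing (a (\<tau> v)) (column w B))"
      by (subst expand[OF that(1)]) (simp add: pairing_sum_left pairing_scale_left)
    also have "\<dots> = 0"
      using that(2) by (intro sum.neutral) (auto simp: dual)
    finally show ?thesis by (simp add: c_def)
  qed
  have cnz: "c j \<noteq> 0" if "j \<in> J" for j
  proof
    assume "c j = 0"
    then have "pairing (a j) (column v B) = 0" for v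
      by (simp add: c_def vec_eq_iff)
    then have "a j = 0" using expand[OF that] by simp
    with a[OF that] show False by simp
  qed
  \<comment> \<open>The \<open>l H\<close> come from the irreducibility assumption and are tied to
    the \<open>a j\<close> only by their zeros, hence the scalar.\<close>
  have form: "\<exists>k. k \<noteq> 0 \<and> lin_change B (l H) = Const k * linform (c j)"
    if j: "j \<in> J" and H: "H = zeros (linform (a j))" for H j
  proof -
    have "H \<in> D'" using j H D' by blast
    then obtain k where k: "k \<noteq> 0" "l H = Const k * linform (a j)"
      using linear_poly_same_zeros[OF _ a[OF j]] l H by metis
    have "lin_change B (linform (a j)) = linform (c j)"
      unfolding lin_change_linform c_def column_def ..
    then have "lin_change B (l H) = Const k * linform (c j)"
      unfolding k(2) lin_change_eq_insertion by (simp add: Const.insertion_simps)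
    with k show ?thesis by blast
  qed
  define P where "P H = lin_change B (l H)" for H
  have P: "\<exists>j k. j \<in> J \<and> k \<noteq> 0 \<and> P H = Const k * linform (c j)" if "H \<in> D'" for H
    using that form unfolding D' P_def by blast
  have varsP: "vars (Const k * linform (c j)) \<subseteq> {v. c j $ v \<noteq> 0}" for k j
    using vars_linform[of "k *s c j"] by (auto simp: linform_scale)
  \<comment> \<open>A nonempty product of nonzero forms is nonzero and vanishes at the origin, so it
    is not constant.\<close>
  have key: "vars (\<Prod>H\<in>E. P H) \<noteq> {}" if E: "E \<subseteq> D'" and H: "H \<in> E" for E H
  proof
    assume empty: "vars (\<Prod>H\<in>E. P H) = {}"
    have finE: "finite E" using E fin finite_subset by blast
    have zero: "peval 0 (P H) = 0" "P H \<noteq> 0" if HE: "H \<in> E" for H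
    proof -
      obtain j k where "j \<in> J" "k \<noteq> 0" "P H = Const k * linform (c j)"
        using P HE E by blast
      then show "peval 0 (P H) = 0" "P H \<noteq> 0"
        using cnz[of j] by (simp_all add: peval.insertion_simps peval_linform)
    qed
    have "peval 0 (\<Prod>H\<in>E. P H) = 0"
      unfolding peval.insertion_prod using finE H zero by (intro prod_zero) auto
    then have "(\<Prod>H\<in>E. P H) = 0" by (rule vars_eq_empty[OF empty])
    then show False using finE zero by auto
  qed
  define D1 where "D1 = {H \<in> D'. vars (P H) \<subseteq> T}"
  define D2 where "D2 = D' - D1"
  \<comment> \<open>A form outside \<open>D1\<close> involves an element of \<open>S - T\<close>,
    hence by \<open>contra\<close> none of \<open>T\<close>.\<close>
  have sub2: "vars (P H) \<subseteq> S - T" if H: "H \<in> D2" for H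
  proof -
    have "H \<in> D'" using H by (simp add: D2_def)
    then obtain j k where jk: "j \<in> J" "k \<noteq> 0" "P H = Const k * linform (c j)"
      using P by blast
    have "\<not> vars (P H) \<subseteq> T" using H by (auto simp: D1_def D2_def)
    then obtain w where w: "w \<in> vars (P H)" "w \<notin> T" by (auto simp: subset_iff)
    have vc: "vars (P H) \<subseteq> {v. c j $ v \<noteq> 0}"
      unfolding jk(3) by (rule varsP)
    have vS: "vars (P H) \<subseteq> S"
      using vc cS[OF jk(1)] by (auto dest!: subsetD)
    have "w \<in> S - T" "c j $ w \<noteq> 0"
      using w vc vS by auto
    then have "\<not> (\<exists>v\<in>T. c j $ v \<noteq> 0)"
      using contra jk(1) unfolding c_def vec_lambda_beta by blast
    then show ?thesis
      using vc vS by blast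
  qed
  \<comment> \<open>In the coordinates \<open>B\<close> the basis form of v is a multiple of the
    variable v. Basis elements inside and outside \<open>T\<close> thus make both \<open>D1\<close>
    and \<open>D2\<close> nonempty.\<close>
  have single: "\<exists>H\<in>D'. vars (P H) \<subseteq> {v}" if v: "v \<in> S" for v
  proof -
    have "\<tau> v \<in> J" using v \<tau> by blast
    then obtain k where "P (zeros (linform (a (\<tau> v)))) = Const k * linform (c (\<tau> v))"
      using form unfolding P_def by blast
    moreover have "{w. c (\<tau> v) $ w \<noteq> 0} \<subseteq> {v}"
      using v by (auto simp: c_def dual)
    ultimately have "vars (P (zeros (linform (a (\<tau> v))))) \<subseteq> {v}"
      using varsP[of k "\<tau> v"] by simp
    with \<open>\<tau> v \<in> J\<close> show ?thesis unfolding D' by blast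
  qed
  obtain v1 v2 where v: "v1 \<in> T" "v2 \<in> S - T" using T by blast
  obtain H1 where "H1 \<in> D'" "vars (P H1) \<subseteq> {v1}" using single v T by blast
  then have H1: "H1 \<in> D1" using v by (auto simp: D1_def)
  obtain H2 where H2: "H2 \<in> D'" "vars (P H2) \<subseteq> {v2}" using single v by blast
  have "vars (P H2) \<noteq> {}" using key[of "{H2}" H2] H2 by simp
  then have H2': "H2 \<in> D2" using H2 v by (auto simp: D1_def D2_def)
  have "D' = D1 \<union> D2" "D1 \<inter> D2 = {}" by (auto simp: D1_def D2_def)
  then have "lin_change B q = (\<Prod>H\<in>D1. P H) * (\<Prod>H\<in>D2. P H)"
    unfolding q lin_change_eq_insertion Const.insertion_prod
    using prod.union_disjoint[of D1 D2 P] fin by (simp add: P_def lin_change_eq_insertion)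
  moreover have "vars (\<Prod>H\<in>D1. P H) \<noteq> {}"
    by (rule key[OF _ H1]) (auto simp: D1_def)
  moreover have "vars (\<Prod>H\<in>D2. P H) \<noteq> {}"
    by (rule key[OF _ H2']) (auto simp: D2_def)
  ultimately have "vars (\<Prod>H\<in>D1. P H) \<inter> vars (\<Prod>H\<in>D2. P H) \<noteq> {}"
    by (rule nosplit[OF B])
  moreover have "vars (\<Prod>H\<in>D1. P H) \<subseteq> T"
    by (rule vars_prod) (simp add: D1_def)
  moreover have "vars (\<Prod>H\<in>D2. P H) \<subseteq> S - T"
    by (rule vars_prod) (rule sub2)
  ultimately show False by blast
qed

section \<open>Polynomial functions\<close>

lemma peval_line: "\<exists>P. \<forall>t. peval (\<chi> j. p j + t * q j) b = poly P t"
proof (intro exI allI)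
  fix t
  show "peval (\<chi> j. p j + t * q j) b
    = poly (\<Sum>m\<in>Poly_Mapping.keys b. [:Poly_Mapping.lookup b m:] * (\<Prod>v\<in>UNIV. [:p v, q v:] ^ Poly_Mapping.lookup m v)) t"
    by (simp add: peval_def poly_sum poly_prod poly_power)
qed

text \<open>Induction on the set \<open>T\<close> of coordinates not confined to natural numbers:
  with the others fixed, the function is a polynomial in the newly released coordinate and has all
  natural numbers as roots.\<close>

lemma zero_on_nat_grid:
  fixes \<Omega> :: "('r::finite \<Rightarrow> complex) \<Rightarrow> complex"
  assumes line: "\<And>p q. \<exists>P. \<forall>t. \<Omega> (\<lambda>j. p j + t * q j) = poly P t"
    and zero: "\<And>n :: 'r \<Rightarrow> nat. \<Omega> (\<lambda>j. of_nat (n j)) = 0"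
  shows "\<Omega> z = 0"
proof -
  have "\<Omega> z = 0" if "\<And>j. j \<notin> T \<Longrightarrow> z j \<in> \<nat>" for z T
    using finite[of T] that
  proof (induction T arbitrary: z rule: finite_induct)
    case empty
    then have "\<forall>j. \<exists>n. z j = of_nat n" by (simp add: Nats_def image_iff)
    then obtain n :: "'r \<Rightarrow> nat" where "z = (\<lambda>j. of_nat (n j))"
      by (metis ext)
    then show ?case using zero by simp
  next
    case (insert i T)
    define p where "p = z(i := 0)"
    define q :: "'r \<Rightarrow> complex" where "q = (\<lambda>j. if j = i then 1 else 0)"
    obtain P where P: "\<And>t. \<Omega> (\<lambda>j. p j + t * q j) = poly P t"
      using line[of p q] by blast
    have "poly P (of_nat n) = 0" for n
      unfolding P[symmetric] by (rule insert.IH) (use insert.prems in \<open>auto simp: p_def q_def\<close>)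
    then have "range of_nat \<subseteq> {x. poly P x = 0}" by auto
    then have "infinite {x. poly P x = 0}"
      using infinite_super range_inj_infinite inj_of_nat by blast
    then have "P = 0" using poly_roots_finite by blast
    moreover have "z = (\<lambda>j. p j + z i * q j)"
      by (auto simp: p_def q_def)
    ultimately show ?case using P[of "z i"] by simp
  qed
  from this[of UNIV] show ?thesis by simp
qed

section \<open>Hyperplanes of a factorized arrangement\<close>

text \<open>Both factorizations have the zero set of f. A hyperplane from either side is thus
  covered by finitely many from the other side, so it lies in one of them by
  \<open>avoid_affine_zeros\<close>, and equals it by \<open>hyperplane_subset\<close>.\<close>

lemma arrangement_hyperplanes:
  fixes fs :: "'r::finite \<Rightarrow> 'n::{finite,linorder} cpoly"
  assumes D: "central_arrangement D f"
    and fs: "\<And>j. fs j = linform (a j)" "\<And>j. a j \<noteq> 0" "(\<Prod>j\<in>UNIV. fs j) = f"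
  shows "finite D" "D = range (\<lambda>j. zeros (fs j))"
proof -
  obtain l m where fin: "finite D"
    and l: "\<And>H. H \<in> D \<Longrightarrow> linear_poly (l H)" "\<And>H. H \<in> D \<Longrightarrow> H = zeros (l H)"
      "\<And>H. H \<in> D \<Longrightarrow> (1::nat) \<le> m H"
    and f: "f = (\<Prod>H\<in>D. l H ^ m H)"
    using D unfolding central_arrangement_def by blast
  show "finite D" by fact
  have "\<exists>c a. a \<noteq> 0 \<and> l H = Const c + linform a" if "H \<in> D" for H
    using linear_polyE[OF l(1)[OF that]] by metis
  then obtain c' a' where l': "\<And>H. H \<in> D \<Longrightarrow> a' H \<noteq> 0" "\<And>H. H \<in> D \<Longrightarrow> l H = Const (c' H) + linform (a' H)"
    by metis
  have H: "H = {x. c' H + pairing (a' H) x = 0}" if "H \<in> D" for H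
    using l(2)[OF that] l'(2)[OF that] by (simp add: zeros_affine)
  have Z: "zeros (fs j) = {x. 0 + pairing (a j) x = 0}" for j
    by (simp add: fs zeros_linform)
  have f0: "(\<exists>j. x \<in> zeros (fs j)) \<longleftrightarrow> (\<exists>H\<in>D. x \<in> H)" for x
  proof -
    have "(\<exists>j. peval x (fs j) = 0) \<longleftrightarrow> peval x f = 0"
      by (simp add: peval.insertion_prod flip: fs(3))
    also have "\<dots> \<longleftrightarrow> (\<exists>H\<in>D. peval x (l H) = 0)"
      using fin l(3) by (force simp: f peval.insertion_prod peval.insertion_power)
    also have "\<dots> \<longleftrightarrow> (\<exists>H\<in>D. x \<in> H)"
      using l(2) by (metis (mono_tags, lifting) mem_Collect_eq zeros_def)
    finally show ?thesis by (simp add: zeros_def)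
  qed
  have eq1: "\<exists>j. H = zeros (fs j)" if HD: "H \<in> D" for H
  proof -
    have "\<exists>j. \<forall>x\<in>H. 0 + pairing (a j) x = 0"
    proof (rule ccontr)
      assume "\<nexists>j. \<forall>x\<in>H. 0 + pairing (a j) x = 0"
      moreover have "line_closed H" by (subst H[OF HD]) (rule line_closed_hyperplane)
      moreover have "H \<noteq> {}" using hyperplane_nonempty[OF l'(1)[OF HD]] H[OF HD] by blast
      ultimately obtain x where "x \<in> H" "\<forall>j. 0 + pairing (a j) x \<noteq> 0"
        using avoid_affine_zeros[of UNIV H "\<lambda>_. 0" a] by auto
      then show False using f0[of x] HD unfolding Z by blast
    qed
    then obtain j where "\<And>x. x \<in> H \<Longrightarrow> 0 + pairing (a j) x = 0" by blast
    then obtain k where "k \<noteq> 0" "a j = k *s a' H" "0 = k * c' H"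
      using hyperplane_subset[OF l'(1)[OF HD] fs(2)[of j], of "c' H" 0] H[OF HD] by blast
    then have "H = zeros (fs j)"
      unfolding Z by (subst H[OF HD]) (simp add: pairing_scale_left)
    then show ?thesis ..
  qed
  have eq2: "zeros (fs j) \<in> D" for j
  proof -
    have "\<exists>H\<in>D. \<forall>x\<in>zeros (fs j). c' H + pairing (a' H) x = 0"
    proof (rule ccontr)
      assume "\<not> (\<exists>H\<in>D. \<forall>x\<in>zeros (fs j). c' H + pairing (a' H) x = 0)"
      moreover have "line_closed (zeros (fs j))" unfolding Z by (rule line_closed_hyperplane)
      moreover have "0 \<in> zeros (fs j)" by (simp add: Z)
      ultimately obtain x where "x \<in> zeros (fs j)" "\<forall>H\<in>D. c' H + pairing (a' H) x \<noteq> 0"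
        using avoid_affine_zeros[OF fin, of "zeros (fs j)" c' a'] by blast
      then show False using f0[of x] H by blast
    qed
    then obtain H0 where H0: "H0 \<in> D" "\<And>x. 0 + pairing (a j) x = 0 \<Longrightarrow> c' H0 + pairing (a' H0) x = 0"
      unfolding Z by blast
    then obtain k where "k \<noteq> 0" "a' H0 = k *s a j" "c' H0 = k * 0"
      using hyperplane_subset[OF fs(2)[of j] l'(1)[OF H0(1)], of 0 "c' H0"] by blast
    then have "H0 = zeros (fs j)"
      unfolding Z by (subst H[OF H0(1)]) (simp add: pairing_scale_left)
    with H0 show ?thesis by simp
  qed
  show "D = range (\<lambda>j. zeros (fs j))"
    using eq1 eq2 by auto
qed

theorem theorem1p4:
  fixes f :: "'n::{finite,linorder} cpoly"
    and fs :: "'r::finite \<Rightarrow> 'n cpoly"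
    and D :: "(complex ^ ('n::{finite,linorder})) set set"
    and W :: "(complex ^ ('n::{finite,linorder})) set"
    and k :: nat
  assumes "central_arrangement D f"
    and "complete_factorization fs f"
    and "dense_edge D W"
    and "k < card (edge_indices W fs)"
  shows "{s :: complex ^ 'r. (\<Sum>j\<in>edge_indices W fs. s $ j) + of_nat (edge_rank W) + of_nat k = 0}
           \<subseteq> zero_locus (bernstein_sato_ideal fs)"
proof -
  define J where "J = edge_indices W fs"
  have "\<exists>a. a \<noteq> 0 \<and> fs j = linform a" for j
    using assms(2) linear_polyE[of "fs j"] unfolding complete_factorization_def
    by (metis Const_zero add_0)
  then obtain a where a: "\<And>j. a j \<noteq> 0" and fs: "\<And>j. fs j = linform (a j)"
    by metis
  have prodfs: "(\<Prod>j\<in>UNIV. fs j) = f"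
    using assms(2) by (simp add: complete_factorization_def)
  have finD: "finite D" and D: "D = range (\<lambda>j. zeros (fs j))"
    using arrangement_hyperplanes[OF assms(1) fs a prodfs] by auto
  have Z: "zeros (fs j) = {x. pairing (a j) x = 0}" for j
    by (simp add: fs zeros_linform)
  have J: "j \<in> J \<longleftrightarrow> W \<subseteq> zeros (fs j)" for j
    by (simp add: J_def edge_indices_def)
  have W: "W = {x. \<forall>j\<in>J. pairing (a j) x = 0}"
  proof -
    obtain \<B> where \<B>: "\<B> \<subseteq> D" "W = \<Inter>\<B>"
      using assms(3) unfolding dense_edge_def intersection_lattice_def by blast
    show ?thesis
    proof (rule set_eqI, rule iffI)
      fix x assume "x \<in> W"
      then show "x \<in> {x. \<forall>j\<in>J. pairing (a j) x = 0}"
        using J Z by blast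
    next
      fix x assume x: "x \<in> {x. \<forall>j\<in>J. pairing (a j) x = 0}"
      have "x \<in> H" if H: "H \<in> \<B>" for H
      proof -
        obtain j where j: "H = zeros (fs j)" using H \<B>(1) D by blast
        then have "j \<in> J" using J \<B>(2) H by blast
        then show ?thesis using x Z j by blast
      qed
      then show "x \<in> W" using \<B>(2) by blast
    qed
  qed
  have loc: "localization D W = (\<lambda>j. zeros (linform (a j))) ` J"
    unfolding localization_def D using J by (auto simp: fs)
  obtain S :: "'n set" and \<tau> :: "'n \<Rightarrow> 'r" and B :: "(complex ^ ('n::{finite,linorder})) ^ ('n::{finite,linorder})"
    where \<tau>: "inj_on \<tau> S" "\<tau> ` S \<subseteq> J" and B: "invertible B"
    and dual: "\<And>v w. v \<in> S \<Longrightarrow> pairing (a (\<tau> v)) (column w B) = (if v = w then 1 else 0)"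
    and expand: "\<And>j. j \<in> J \<Longrightarrow> a j = (\<Sum>v\<in>S. pairing (a j) (column v B) *s a (\<tau> v))"
    and cardS: "card S = CARD('n) - vec.dim {x. \<forall>j\<in>J. pairing (a j) x = 0}"
  proof (rule linear_forms_basis[of J a], goal_cases)
    case (1 S \<tau> B)
    show ?case by (rule that) (fact 1)+
  qed
  have rank: "edge_rank W = card S"
    unfolding edge_rank_def cardS by (subst W) (rule refl)
  define C where "C j v = pairing (a j) (column v B)" for j v
  have row: "\<exists>v\<in>S. C j v \<noteq> 0" if "j \<in> J" for j
  proof (rule ccontr)
    assume "\<not> (\<exists>v\<in>S. C j v \<noteq> 0)"
    then have "(\<Sum>v\<in>S. pairing (a j) (column v B) *s a (\<tau> v)) = 0"
      by (intro sum.neutral) (simp add: C_def)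
    then show False using expand[OF that] a by metis
  qed
  have "J \<noteq> {}" using assms(4) by (auto simp: J_def)
  then obtain r where r: "r \<in> S" using row by blast
  define J' where "J' = J - \<tau> ` S"
  have dense: "support_dense C J' S"
  proof (rule support_dense_connected[OF _ _ r])
    fix j assume "j \<in> J'"
    then show "\<exists>v\<in>S. C j v \<noteq> 0" using row by (simp add: J'_def)
  next
    fix T assume T: "T \<noteq> {}" "T \<subset> S"
    have "irreducible_arrangement (localization D W)"
      using assms(3) by (simp add: dense_edge_def)
    then obtain j where j: "j \<in> J" "\<exists>v\<in>T. C j v \<noteq> 0" "\<exists>v\<in>S - T. C j v \<noteq> 0"
      using irreducible_connected[OF _ _ loc a \<tau> B dual expand T] finD
      unfolding C_def localization_def by auto
    \<comment> \<open>A basis form involves a single basis element, so it cannot meet both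
      \<open>T\<close> and \<open>S - T\<close>.\<close>
    have "j \<notin> \<tau> ` S"
    proof
      assume "j \<in> \<tau> ` S"
      then obtain v where "v \<in> S" "j = \<tau> v" by blast
      with j(2,3) show False by (auto simp: C_def dual split: if_splits)
    qed
    with j show "\<exists>j\<in>J'. (\<exists>v\<in>T. C j v \<noteq> 0) \<and> (\<exists>v\<in>S - T. C j v \<noteq> 0)"
      by (auto simp: J'_def)
  qed simp_all
  \<comment> \<open>A generic point of W exists because no form outside \<open>J\<close> vanishes
    identically on W.\<close>
  obtain y where y: "y \<in> W" "\<And>j. j \<notin> J \<Longrightarrow> pairing (a j) y \<noteq> 0"
  proof -
    have "line_closed W"
      unfolding line_closed_def
      by (subst (1 2 3) W) (simp add: pairing_add_right pairing_scale_right pairing_diff_right del: vec.scale_right_diff_distrib vector_ssub_ldistrib)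
    moreover have "W \<noteq> {}" using W by (auto intro: exI[of _ 0])
    moreover have "\<exists>x\<in>W. 0 + pairing (a j) x \<noteq> 0" if "j \<in> - J" for j
      using that J[of j] Z by auto
    ultimately show thesis
      using avoid_affine_zeros[of "- J" W "\<lambda>_. 0" a] that by auto
  qed
  show ?thesis
  proof (intro subsetI)
    fix s :: "complex ^ 'r"
    assume "s \<in> {s. (\<Sum>j\<in>edge_indices W fs. s $ j) + of_nat (edge_rank W) + of_nat k = 0}"
    then have s: "(\<Sum>j\<in>J. s $ j) + of_nat (card S) + of_nat k = 0"
      by (simp add: J_def rank)
    show "s \<in> zero_locus (bernstein_sato_ideal fs)"
      unfolding zero_locus_def
    proof (intro CollectI ballI)
      fix b assume b: "b \<in> bernstein_sato_ideal fs"
      define \<kappa> where "\<kappa> v = (if v = r then k else 0)" for v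
      \<comment> \<open>An affine parametrization: c gives the non-basis exponents in
        \<open>J\<close>, e the basis exponents up to sign and shift, z those outside
        \<open>J\<close>. Equal sums of c over \<open>J'\<close> and e over \<open>S\<close> place
        the point on the hyperplane.\<close>
      define \<alpha> where "\<alpha> c e z j = (if j \<in> \<tau> ` S
          then - 1 - e (the_inv_into S \<tau> j) - of_nat (\<kappa> (the_inv_into S \<tau> j))
          else if j \<in> J then c j else z j)"
        for c z :: "'r \<Rightarrow> complex" and e :: "'n \<Rightarrow> complex" and j
      have inv: "the_inv_into S \<tau> (\<tau> v) = v" if "v \<in> S" for v
        using the_inv_into_f_f[OF \<tau>(1) that] .
      \<comment> \<open>Density frees the coordinates in \<open>J\<close>, while those outside
        \<open>J\<close> remain natural numbers, as nonnegative exponents there are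
        required.\<close>
      have nat_zero: "peval (\<chi> j. \<alpha> c e (\<lambda>j. of_nat (n j)) j) b = 0"
        if c: "\<And>j. j \<notin> J' \<Longrightarrow> c j = 0" and e: "\<And>v. v \<notin> S \<Longrightarrow> e v = 0"
          and sum: "(\<Sum>j\<in>J'. c j) = (\<Sum>v\<in>S. e v)" for c e and n :: "'r \<Rightarrow> nat"
      proof (rule support_denseD[OF dense,
            where \<phi> = "\<lambda>c e. peval (\<chi> j. \<alpha> c e (\<lambda>j. of_nat (n j)) j) b", OF _ _ c e sum])
        show "pol_on_lines (\<lambda>c e. peval (\<chi> j. \<alpha> c e (\<lambda>j. of_nat (n j)) j) b)"
          unfolding pol_on_lines_def
        proof (intro allI)
          fix c c' :: "'r \<Rightarrow> complex" and e e' :: "'n \<Rightarrow> complex"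
          define q where "q j = (if j \<in> \<tau> ` S then - e' (the_inv_into S \<tau> j)
            else if j \<in> J then c' j else 0)" for j
          have "\<alpha> (\<lambda>j. c j + t * c' j) (\<lambda>v. e v + t * e' v) (\<lambda>j. of_nat (n j)) j
              = \<alpha> c e (\<lambda>j. of_nat (n j)) j + t * q j" for t j
            by (simp add: \<alpha>_def q_def algebra_simps)
          then show "\<exists>p. \<forall>t. peval (\<chi> j. \<alpha> (\<lambda>j. c j + t * c' j) (\<lambda>v. e v + t * e' v) (\<lambda>j. of_nat (n j)) j) b = poly p t"
            using peval_line by simp
        qed
      next
        fix c :: "'r \<Rightarrow> nat" and e :: "'n \<Rightarrow>\<^sub>0 nat"
        assume e: "Poly_Mapping.keys e \<subseteq> S"
          and sum: "(\<Sum>j\<in>J'. c j) = (\<Sum>v\<in>S. Poly_Mapping.lookup e v)"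
          and nz: "Poly_Mapping.lookup (form_product C J' S c) e \<noteq> 0"
        define c' where "c' j = (if j \<in> J then c j else n j)" for j
        define A where "A j = (if j \<in> \<tau> ` S
          then - 1 - int (Poly_Mapping.lookup e (the_inv_into S \<tau> j) + \<kappa> (the_inv_into S \<tau> j))
          else int (c' j))" for j
        have "peval (\<chi> j. of_int (A j)) b = 0"
        proof (rule bernstein_sato_vanishes_at_coefficient[OF fs a \<tau>, where C = C and d = "\<lambda>v. column v B"
              and y = y and r = r and k = k and c = c' and e = e and \<alpha> = A])
          show "a j = (\<Sum>v\<in>S. C j v *s a (\<tau> v))" if "j \<in> J" for j
            using expand[OF that] by (simp add: C_def)
          show "pairing (a (\<tau> v)) (column w B) = (if v = w then 1 else 0)" if "v \<in> S" for v w
            using dual[OF that] .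
          show "pairing (a j) y = 0" if "j \<in> J" for j
            using y(1) that W by blast
          show "k < card J" using assms(4) by (simp add: J_def)
          have cc: "c' j = c j" if "j \<in> J'" for j
            using that by (simp add: c'_def J'_def)
          then show "(\<Sum>j\<in>J - \<tau> ` S. c' j) = (\<Sum>v\<in>S. Poly_Mapping.lookup e v)"
            using sum by (simp add: J'_def)
          have "form_product C J' S c' = form_product C J' S c"
            unfolding form_product_def by (intro prod.cong) (simp_all add: cc)
          then show "Poly_Mapping.lookup (form_product C (J - \<tau> ` S) S c') e \<noteq> 0"
            using nz by (simp add: J'_def)
          show "A (\<tau> v) = - 1 - int (Poly_Mapping.lookup e v + (if v = r then k else 0))" if "v \<in> S" for v
            using that inv by (simp add: A_def \<kappa>_def)
          show "A j = int (c' j)" if "j \<notin> \<tau> ` S" for j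
            using that by (simp add: A_def)
        qed (use y r b e in auto)
        moreover have "of_int (A j) = \<alpha> (\<lambda>j. of_nat (c j)) (\<lambda>v. of_nat (Poly_Mapping.lookup e v)) (\<lambda>j. of_nat (n j)) j" for j
          by (simp add: A_def \<alpha>_def c'_def)
        ultimately show "peval (\<chi> j. \<alpha> (\<lambda>j. of_nat (c j)) (\<lambda>v. of_nat (Poly_Mapping.lookup e v)) (\<lambda>j. of_nat (n j)) j) b = 0"
          by simp
      qed
      \<comment> \<open>The parameters of the given point s are found by solving the definition of
        \<alpha>; the equation of the hyperplane becomes the equality of the two sums.\<close>
      define c where "c j = (if j \<in> J' then s $ j else 0)" for j
      define e where "e v = (if v \<in> S then - 1 - s $ \<tau> v - of_nat (\<kappa> v) else 0)" for v
      have sum: "(\<Sum>j\<in>J'. c j) = (\<Sum>v\<in>S. e v)"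
      proof -
        have "(\<Sum>j\<in>J. s $ j) = (\<Sum>j\<in>J'. s $ j) + (\<Sum>v\<in>S. s $ \<tau> v)"
          using sum.subset_diff[OF \<tau>(2), of "\<lambda>j. s $ j"] \<tau>(1) by (simp add: J'_def sum.reindex)
        moreover have "(\<Sum>v\<in>S. e v) = - of_nat (card S) - (\<Sum>v\<in>S. s $ \<tau> v) - of_nat (\<Sum>v\<in>S. \<kappa> v)"
          by (simp add: e_def sum_subtractf cong: sum.cong)
        moreover have "of_nat (\<Sum>v\<in>S. \<kappa> v) = (of_nat k :: complex)"
          using r by (simp add: \<kappa>_def)
        moreover have "(\<Sum>j\<in>J'. c j) = (\<Sum>j\<in>J'. s $ j)"
          by (simp add: c_def)
        ultimately show ?thesis
          using s by algebra
      qed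
      \<comment> \<open>The coordinates outside \<open>J\<close>, natural so far, are now
        released.\<close>
      have "peval (\<chi> j. \<alpha> c e (\<lambda>j. s $ j) j) b = 0"
      proof (rule zero_on_nat_grid[where \<Omega> = "\<lambda>z. peval (\<chi> j. \<alpha> c e z j) b"])
        fix p q :: "'r \<Rightarrow> complex"
        define q' where "q' j = (if j \<in> J then 0 else q j)" for j
        have "\<alpha> c e (\<lambda>j. p j + t * q j) j = \<alpha> c e p j + t * q' j" for t j
          using \<tau>(2) by (auto simp: \<alpha>_def q'_def)
        then show "\<exists>P. \<forall>t. peval (\<chi> j. \<alpha> c e (\<lambda>j. p j + t * q j) j) b = poly P t"
          using peval_line by simp
      next
        fix n :: "'r \<Rightarrow> nat"
        show "peval (\<chi> j. \<alpha> c e (\<lambda>j. of_nat (n j)) j) b = 0"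
          by (rule nat_zero[OF _ _ sum]) (simp_all add: c_def e_def)
      qed
      moreover have "\<alpha> c e (\<lambda>j. s $ j) j = s $ j" for j
        using inv by (auto simp: \<alpha>_def c_def e_def J'_def)
      ultimately show "peval s b = 0" by (simp add: vec_lambda_eta)
    qed
  qed
qed

end
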